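(* Let $q\in\mathbb{N}$, let $G$ be a locally compact abelian group with dual group $\Gamma$, $\lambda$ a Haar measure on the Borel $\sigma$-algebra of $\Gamma$, $S\subseteq G$ nonempty, and $W$ a Borel measurable $\lambda$-integrable function on $\Gamma$ with values in the positive semidefinite Hermitian complex $q\times q$ matrices. Let $s\in S$ and $k\in\{1,\dots,q\}$. Then $$\inf\left\{\left[\int_\Gamma(\chi_se_k-t)^*W(\chi_se_k-t)\,d\lambda\right]^{1/2}: t\in\mathcal{T}(G\setminus S)\right\}=\sup\left\{\left[\int_\Gamma h^*W^+h\,d\lambda\right]^{-1/2}: h\in\tilde{\mathcal{D}}_{s,k}\right\},$$ where the right-hand side is to be interpreted as $0$ if $\tilde{\mathcal{D}}_{s,k}$ is empty.
   Context: $X^*$ is the adjoint (conjugate transpose) of a matrix or column vector $X$ and $X^+$ its Moore-Penrose inverse, applied pointwise to functions. For $x\in G$, $\chi_x(\gamma):=\langle\gamma,x\rangle$ is the value of $\gamma\in\Gamma$ at $x$; $e_1,\dots,e_q$ is the standard orthonormal basis of $\mathbb{C}^q$ (column vectors). If $G\setminus S\neq\emptyset$, $\mathcal{T}(G\setminus S)$ is the linear space of all functions $\sum_{j=1}^n\chi_{x_j}u_j$ with $n\in\mathbb{N}$, $x_j\in G\setminus S$, $u_j\in\mathbb{C}^q$; if $G\setminus S=\emptyset$, it is $\{0\}$. $L^2(W^+)$ is the space of (classes of) Borel measurable functions $h:\Gamma\to\mathbb{C}^q$ with $\int_\Gamma h^*W^+h\,d\lambda<\infty$, where two functions are identified if their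 pointwise orthogonal projections onto the range of $W(\gamma)$ agree $\lambda$-a.e., and, as a standing convention, representatives are always chosen with $h(\gamma)$ in the range of $W(\gamma)$ for all $\gamma\in\Gamma$. Such $h$ are $\lambda$-integrable. For $h\in L^2(W^+)$ and $x\in G$ set $(h^* )^\vee(x):=\int_\Gamma\langle\gamma,x\rangle h(\gamma)^*\lambda(d\gamma)$ (a row vector). Define $$\tilde{\mathcal{D}}:=\{h\in L^2(W^+): (h^* )^\vee(x)=0\text{ for all }x\in G\setminus S\},\qquad \tilde{\mathcal{D}}_{s,k}:=\{h\in\tilde{\mathcal{D}}: (h^* )^\vee(s)e_k=1\}.$$ *)

theory Defs
  imports "HOL-Analysis.Analysis"
begin

section \<open>Complex matrices and vectors\<close>

text \<open>Row vectors are represented by the same type as column vectors; \<open>row_col r v\<close> is the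
  scalar obtained by multiplying the row \<open>r\<close> by the column \<open>v\<close> (no conjugation).\<close>

definition row_col :: "complex ^ 'n \<Rightarrow> complex ^ 'n \<Rightarrow> complex" where
  "row_col r v = (\<Sum>i\<in>UNIV. r $ i * v $ i)"

definition vec_adj :: "complex ^ 'n \<Rightarrow> complex ^ 'n" where
  "vec_adj v = (\<chi> i. cnj (v $ i))"

definition mat_adj :: "complex ^ 'n ^ 'm \<Rightarrow> complex ^ 'm ^ 'n" where
  "mat_adj A = (\<chi> i j. cnj (A $ j $ i))"

text \<open>The number $v^* A v$; for Hermitian \<open>A\<close> it is real, so taking the real part only
  changes the type.\<close>

definition qform :: "complex ^ 'n ^ 'n \<Rightarrow> complex ^ 'n \<Rightarrow> real" where
  "qform A v = Re (row_col (vec_adj v) (A *v v))"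

definition pos_semidef :: "complex ^ 'n ^ 'n \<Rightarrow> bool" where
  "pos_semidef A \<longleftrightarrow> mat_adj A = A \<and> (\<forall>v. 0 \<le> qform A v)"

definition is_mp_inverse :: "complex ^ 'n ^ 'm \<Rightarrow> complex ^ 'm ^ 'n \<Rightarrow> bool" where
  "is_mp_inverse A X \<longleftrightarrow>
     A ** X ** A = A \<and> X ** A ** X = X \<and>
     mat_adj (A ** X) = A ** X \<and> mat_adj (X ** A) = X ** A"

definition mp_inverse :: "complex ^ 'n ^ 'm \<Rightarrow> complex ^ 'm ^ 'n" where
  "mp_inverse A = (THE X. is_mp_inverse A X)"

lemma mat_adj_mult: "mat_adj (A ** B) = mat_adj B ** mat_adj A"
  by (simp add: mat_adj_def matrix_matrix_mult_def vec_eq_iff mult.commute)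

lemma is_mp_inverse_unique:
  assumes X: "is_mp_inverse A X" and Y: "is_mp_inverse A Y"
  shows "X = Y"
proof -
  have AX: "A ** X = A ** Y"
  proof -
    have "A ** X = mat_adj (A ** X)" using X by (simp add: is_mp_inverse_def)
    also have "\<dots> = mat_adj ((A ** Y) ** (A ** X))"
      using Y by (simp add: is_mp_inverse_def matrix_mul_assoc)
    also have "\<dots> = (A ** X) ** (A ** Y)"
      using X Y by (simp add: is_mp_inverse_def mat_adj_mult [of "A ** Y"])
    also have "\<dots> = A ** Y" using X by (simp add: is_mp_inverse_def matrix_mul_assoc)
    finally show ?thesis .
  qed
  have XA: "X ** A = Y ** A"
  proof -
    have "X ** A = mat_adj (X ** A)" using X by (simp add: is_mp_inverse_def)
    also have "\<dots> = mat_adj ((X ** A) ** (Y ** A))"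
      using Y by (simp add: is_mp_inverse_def flip: matrix_mul_assoc)
    also have "\<dots> = (Y ** A) ** (X ** A)"
      using X Y by (simp add: is_mp_inverse_def mat_adj_mult [of "X ** A"])
    also have "\<dots> = Y ** A" using X by (simp add: is_mp_inverse_def flip: matrix_mul_assoc)
    finally show ?thesis .
  qed
  have "X = X ** (A ** X)" using X by (simp add: is_mp_inverse_def matrix_mul_assoc)
  also have "\<dots> = (Y ** A) ** Y" by (simp add: AX matrix_mul_assoc flip: XA)
  also have "\<dots> = Y" using Y by (simp add: is_mp_inverse_def)
  finally show ?thesis .
qed


section \<open>The dual group and Haar measures\<close>

text \<open>The group \<open>G\<close> is a type, written additively. An element \<open>\<gamma>\<close> of its dual group is itself the
  character, so $\langle\gamma,x\rangle$ is \<open>\<gamma> x\<close>; the group operation is pointwise multiplication.\<close>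

definition dual_group :: "('g::topological_ab_group_add \<Rightarrow> complex) set" where
  "dual_group = {\<gamma>. continuous_on UNIV \<gamma> \<and> (\<forall>x. norm (\<gamma> x) = 1) \<and>
                     (\<forall>x y. \<gamma> (x + y) = \<gamma> x * \<gamma> y)}"

definition dual_mult :: "('g \<Rightarrow> complex) \<Rightarrow> ('g \<Rightarrow> complex) \<Rightarrow> 'g \<Rightarrow> complex" where
  "dual_mult \<gamma> \<eta> = (\<lambda>x. \<gamma> x * \<eta> x)"

text \<open>The compact-open topology.\<close>

definition dual_topology :: "('g::topological_ab_group_add \<Rightarrow> complex) topology" where
  "dual_topology =
     topology_generated_by {{\<gamma> \<in> dual_group. \<gamma> ` K \<subseteq> U} |K U. compact K \<and> open U}"

lemma topspace_dual_topology [simp]: "topspace dual_topology = dual_group"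
proof -
  have "dual_group \<in> {{\<gamma> \<in> dual_group. \<gamma> ` K \<subseteq> U} |K U. compact K \<and> open U}"
    by (rule CollectI, rule exI [of _ "{}"], rule exI [of _ "{}"]) simp
  then have "\<Union>{{\<gamma> \<in> dual_group. \<gamma> ` K \<subseteq> U} |K U. compact K \<and> open U} = dual_group"
    by blast
  then show ?thesis
    by (simp add: dual_topology_def)
qed

text \<open>Haar measure on the Borel $\sigma$-algebra of the topological group with topology \<open>T\<close> and
  multiplication \<open>m\<close>: a nonzero translation invariant Radon measure, with the usual convention
  that a Radon measure is finite on compact sets, outer regular on Borel sets and inner regular on
  open sets. (The carrier of \<open>M\<close> is determined by the $\sigma$-algebra.)\<close>

definition haar_measure :: "'a topology \<Rightarrow> ('a \<Rightarrow> 'a \<Rightarrow> 'a) \<Rightarrow> 'a measure \<Rightarrow> bool" where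
  "haar_measure T m M \<longleftrightarrow>
     sets M = sigma_sets (topspace T) {U. openin T U} \<and>
     (\<forall>K. compactin T K \<and> K \<in> sets M \<longrightarrow> emeasure M K < \<infinity>) \<and>
     (\<forall>A\<in>sets M. emeasure M A = (INF U\<in>{U. openin T U \<and> A \<subseteq> U}. emeasure M U)) \<and>
     (\<forall>U. openin T U \<longrightarrow>
        emeasure M U = (SUP K\<in>{K. compactin T K \<and> K \<in> sets M \<and> K \<subseteq> U}. emeasure M K)) \<and>
     (\<forall>a\<in>topspace T. \<forall>A\<in>sets M. emeasure M (m a ` A) = emeasure M A) \<and>
     emeasure M (topspace T) \<noteq> 0"


section \<open>Trigonometric polynomials and the dual extremal problem\<close>

text \<open>The space $\mathcal{T}(X)$. Since \<open>n = 0\<close> is allowed it is $\{0\}$ for empty \<open>X\<close>.\<close>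

definition trig_polys :: "'g set \<Rightarrow> (('g \<Rightarrow> complex) \<Rightarrow> complex ^ 'q) set" where
  "trig_polys X = {\<lambda>\<gamma>. \<Sum>j<n. \<gamma> (x j) *s u j |(n::nat) x u. \<forall>j<n. x j \<in> X}"

text \<open>$L^2(W^+)$, as a set of representatives with values in the range of \<open>W\<close>. Every class has
  such representatives, any two of them agree almost everywhere, and everything below depends only on
  the class.\<close>

definition L2_mp :: "'a measure \<Rightarrow> ('a \<Rightarrow> complex ^ 'q ^ 'q) \<Rightarrow> ('a \<Rightarrow> complex ^ 'q) set" where
  "L2_mp M W = {h. h \<in> borel_measurable M \<and>
                   (\<forall>\<gamma>\<in>space M. h \<gamma> \<in> range (\<lambda>v. W \<gamma> *v v)) \<and>
                   (\<integral>\<^sup>+ \<gamma>. ennreal (qform (mp_inverse (W \<gamma>)) (h \<gamma>)) \<partial>M) < \<infinity>}"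

text \<open>The row vector $(h^*)^\vee(x)$.\<close>

definition inv_fourier_adj ::
    "('g \<Rightarrow> complex) measure \<Rightarrow> (('g \<Rightarrow> complex) \<Rightarrow> complex ^ 'q) \<Rightarrow> 'g \<Rightarrow> complex ^ 'q" where
  "inv_fourier_adj M h x = (\<integral>\<gamma>. \<gamma> x *s vec_adj (h \<gamma>) \<partial>M)"

definition D_tilde ::
    "('g \<Rightarrow> complex) measure \<Rightarrow> (('g \<Rightarrow> complex) \<Rightarrow> complex ^ 'q ^ 'q) \<Rightarrow> 'g set
      \<Rightarrow> (('g \<Rightarrow> complex) \<Rightarrow> complex ^ 'q) set" where
  "D_tilde M W S = {h \<in> L2_mp M W. \<forall>x\<in>UNIV - S. inv_fourier_adj M h x = 0}"

definition D_tilde_at ::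
    "('g \<Rightarrow> complex) measure \<Rightarrow> (('g \<Rightarrow> complex) \<Rightarrow> complex ^ 'q ^ 'q) \<Rightarrow> 'g set \<Rightarrow> 'g \<Rightarrow> 'q
      \<Rightarrow> (('g \<Rightarrow> complex) \<Rightarrow> complex ^ 'q) set" where
  "D_tilde_at M W S s k =
     {h \<in> D_tilde M W S. row_col (inv_fourier_adj M h s) (axis k 1) = 1}"

end

theory Submission
  imports Defs
begin

text \<open>The equality is the duality between a distance and norming functionals in the Hilbert space
  \<open>L\<^sup>2(W)\<close>. Multiplication by \<open>W\<close> identifies \<open>L\<^sup>2(W)\<close> isometrically with \<open>L\<^sup>2(W\<^sup>+)\<close>, and the pairing
  \<open>\<integral> h\<^sup>* f\<close> of \<open>h \<in> L\<^sup>2(W\<^sup>+)\<close> with \<open>f \<in> L\<^sup>2(W)\<close> is the inner product. Under this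
  identification \<open>D_tilde\<close> is the orthogonal complement of the trigonometric polynomials with
  frequencies outside \<open>S\<close>, and \<open>D_tilde_at\<close> consists of its elements whose pairing with
  \<open>g = \<chi>\<^sub>s e\<^sub>k\<close> is \<open>1\<close>.

  An element \<open>h\<close> of \<open>D_tilde_at\<close> pairs to \<open>1\<close> with every \<open>g - t\<close>, so by the Cauchy-Schwarz inequality
  (\<open>L2_mp_pairing_bound\<close>) the infimum is at least each term of the supremum. Conversely, if the
  distance \<open>r\<close> is positive, a minimising sequence \<open>f\<^sub>n = g - t\<^sub>n\<close> is Cauchy, and the limit \<open>h\<close> of
  \<open>W f\<^sub>n\<close> annihilates the polynomials, pairs to \<open>r\<^sup>2\<close> with \<open>g\<close>, and has norm at most \<open>r\<close>
  (\<open>extremal_functional_exists\<close>); hence \<open>h / r\<^sup>2\<close> lies in \<open>D_tilde_at\<close> and its term is at least \<open>r\<close>.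
  If the distance is \<open>0\<close>, only the first half is needed, the terms of the supremum being nonnegative.

  Two devices carry the analysis. The real inner product \<open>u \<bullet> v\<close>, the real part of \<open>u\<^sup>* v\<close>, is used
  throughout, and complex statements are recovered by also testing with imaginary multiples. And the
  integrand \<open>h\<^sup>* W\<^sup>+ h\<close> is the maximum of \<open>2 (h \<bullet> u) - u\<^sup>* W u\<close> over all vectors \<open>u\<close>
  (\<open>mp_form_lower\<close>, \<open>mp_form_attained\<close>), from which its measurability, the pairing inequality and
  Fatou's lemma for it follow. Convergence takes place in \<open>L\<^sup>1\<close>, where \<open>\<parallel>W f\<parallel>\<close> is controlled by
  \<open>\<parallel>W\<parallel>\<close> and \<open>f\<^sup>* W f\<close> (\<open>norm_le_mp_form\<close>).\<close>

section \<open>Quadratic forms and the Moore-Penrose inverse of a Hermitian matrix\<close>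

lemma Re_row_col_vec_adj: "Re (row_col (vec_adj u) v) = inner u v"
  by (simp add: row_col_def vec_adj_def inner_vec_def inner_complex_def)

lemma qform_eq_inner: "qform A v = inner v (A *v v)"
  by (simp add: qform_def Re_row_col_vec_adj)

lemma inner_mat_adj: "inner u (A *v v) = inner (mat_adj A *v u) v"
proof -
  have "row_col (vec_adj u) (A *v v) = row_col (vec_adj (mat_adj A *v u)) v"
    unfolding row_col_def vec_adj_def mat_adj_def matrix_vector_mult_def
    by (simp add: sum_distrib_left sum_distrib_right mult_ac) (rule sum.swap)
  then show ?thesis
    by (metis Re_row_col_vec_adj)
qed

text \<open>A Hermitian matrix is injective on its own range, since \<open>A (A w) = 0\<close> forces
  \<open>\<parallel>A w\<parallel>\<^sup>2 = w \<bullet> A (A w) = 0\<close>; counting dimensions, it maps its range onto itself.\<close>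

lemma hermitian_range_square:
  fixes A :: "complex ^ 'n ^ 'n"
  assumes "mat_adj A = A"
  shows "A *v v \<in> range (\<lambda>w. A *v (A *v w))"
proof -
  let ?L = "(*v) A"
  have lin: "linear ?L"
    by simp
  have sub: "subspace (range ?L)"
    using lin subspace_UNIV by (rule linear_subspace_image)
  have "inj_on ?L (range ?L)"
  proof (rule inj_onI)
    fix x y
    assume x: "x \<in> range ?L" and y: "y \<in> range ?L" and eq: "A *v x = A *v y"
    obtain w where w: "x - y = A *v w"
      using subspace_diff [OF sub x y] by blast
    have "A *v (A *v w) = 0"
      using eq by (simp add: matrix_vector_mult_diff_distrib flip: w)
    then have "inner (A *v w) (A *v w) = 0"
      by (metis assms inner_mat_adj inner_zero_right inner_commute)
    then show "x = y"
      using w by simp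
  qed
  then have "dim (?L ` range ?L) = dim (range ?L)"
    using lin sub by (intro dim_image_eq) (simp_all add: span_eq_iff [THEN iffD2])
  then have "?L ` range ?L = range ?L"
    using lin sub by (intro subspace_dim_equal) (auto simp: linear_subspace_image)
  then show ?thesis
    by blast
qed

text \<open>The equation \<open>A = A\<^sup>2 B\<close>, which is solvable column by column, already
  determines the orthogonal projection \<open>P = A B = B\<^sup>* A\<close> onto the range of \<open>A\<close>, and
  \<open>B\<^sup>* A B\<close> is the pseudoinverse.\<close>

lemma hermitian_mp_inverse_exists:
  fixes A :: "complex ^ 'n ^ 'n"
  assumes "mat_adj A = A"
  shows "\<exists>X. is_mp_inverse A X"
proof -
  have "\<exists>b. \<forall>j. A *v axis j 1 = A *v (A *v b j)"
    using hermitian_range_square [OF assms] by (intro choice) blast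
  then obtain b where b: "\<And>j. A *v axis j 1 = A *v (A *v b j)"
    by blast
  define B :: "complex ^ 'n ^ 'n" where "B = (\<chi> i j. b j $ i)"
  have "(A ** (A ** B)) $ i $ j = A $ i $ j" for i j
  proof -
    have "(A ** (A ** B)) $ i $ j = (A *v (A *v b j)) $ i"
      by (simp add: B_def matrix_matrix_mult_def matrix_vector_mult_def)
    also have "\<dots> = (A *v axis j 1) $ i"
      by (simp add: b)
    also have "\<dots> = A $ i $ j"
      by (simp add: matrix_vector_mult_def axis_def if_distrib [of "(*) _"] cong: if_cong)
    finally show ?thesis .
  qed
  then have AAB: "A ** (A ** B) = A"
    by (simp add: vec_eq_iff)
  define C where "C = mat_adj B"
  have CAA: "C ** (A ** A) = A"
    using arg_cong [OF AAB, of mat_adj]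
    by (simp add: mat_adj_mult assms C_def matrix_mul_assoc)
  define P where "P = A ** B"
  have P: "P = C ** A"
    by (metis AAB CAA P_def matrix_mul_assoc)
  have AP: "A ** P = A" and PA: "P ** A = A"
    using AAB CAA by (simp_all add: P_def) (simp add: P flip: P_def matrix_mul_assoc)
  have PP: "P ** P = P"
    by (metis P PA P_def matrix_mul_assoc)
  have adjP: "mat_adj P = P"
    by (simp add: P_def mat_adj_mult assms) (simp flip: C_def P P_def)
  define X where "X = P ** B"
  have X: "X = C ** P"
    by (simp add: X_def P_def) (simp add: P flip: P_def matrix_mul_assoc)
  have AX: "A ** X = P"
    by (simp add: X_def matrix_mul_assoc AP flip: P_def)
  have XA: "X ** A = P"
    by (metis P PA X matrix_mul_assoc)
  have "is_mp_inverse A X"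
    unfolding is_mp_inverse_def using AX XA adjP PA PP
    by (simp add: X_def matrix_mul_assoc)
  then show ?thesis ..
qed

text \<open>On the range of \<open>A\<close> the form of \<open>A\<^sup>+\<close> can thus be computed from any preimage, without knowing
  \<open>A\<^sup>+\<close>.\<close>

lemma qform_mp_inverse:
  fixes A :: "complex ^ 'n ^ 'n"
  assumes "mat_adj A = A"
  shows "qform (mp_inverse A) (A *v v) = qform A v"
proof -
  have "is_mp_inverse A (mp_inverse A)"
    unfolding mp_inverse_def using hermitian_mp_inverse_exists [OF assms] is_mp_inverse_unique
    by (metis theI)
  then have "A ** mp_inverse A ** A = A"
    by (simp add: is_mp_inverse_def)
  then have "A *v (mp_inverse A *v (A *v v)) = A *v v"
    by (simp add: matrix_vector_mul_assoc matrix_mul_assoc)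
  then show ?thesis
    by (metis assms inner_mat_adj qform_eq_inner)
qed

lemma pos_semidef_adj: "pos_semidef A \<Longrightarrow> mat_adj A = A"
  and pos_semidef_nonneg: "pos_semidef A \<Longrightarrow> 0 \<le> qform A v"
  by (simp_all add: pos_semidef_def)

lemma qform_diff:
  assumes "mat_adj A = A"
  shows "qform A (u - v) = qform A u - 2 * inner (A *v u) v + qform A v"
  using inner_mat_adj [of v A u] assms
  by (simp add: qform_eq_inner matrix_vector_mult_diff_distrib algebra_simps inner_commute)

lemma qform_scaleR: "qform A (c *\<^sub>R v) = c\<^sup>2 * qform A v"
  by (simp add: qform_eq_inner power2_eq_square
      linear_scale [OF matrix_vector_mul_linear])

text \<open>The square \<open>(v - u)\<^sup>* A (v - u) \<ge> 0\<close> expanded at a preimage \<open>v\<close> of \<open>h\<close>. Together with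
  the next lemma it exhibits \<open>h\<^sup>* A\<^sup>+ h\<close> as a maximum over \<open>u\<close> of functions that are affine in \<open>h\<close>
  and in \<open>A\<close>. Every analytic property of this form needed below (measurability, lower
  semicontinuity, the Cauchy-Schwarz inequality) is read off from this description.\<close>

lemma mp_form_lower:
  assumes "pos_semidef A" and "h \<in> range ((*v) A)"
  shows "2 * inner h u - qform A u \<le> qform (mp_inverse A) h"
proof -
  obtain v where v: "h = A *v v"
    using assms(2) by blast
  have "0 \<le> qform A (v - u)"
    using assms(1) by (rule pos_semidef_nonneg)
  then show ?thesis
    using assms(1) by (simp add: v qform_diff qform_mp_inverse pos_semidef_adj)
qed

lemma mp_form_attained:
  assumes "pos_semidef A" and "h \<in> range ((*v) A)"
  obtains u where "2 * inner h u - qform A u = qform (mp_inverse A) h"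
proof -
  obtain v where v: "h = A *v v"
    using assms(2) by blast
  have "2 * inner h v - qform A v = qform (mp_inverse A) h"
    using assms(1) by (simp add: v qform_mp_inverse pos_semidef_adj)
       (simp add: qform_eq_inner inner_commute)
  then show thesis ..
qed

lemma mp_form_nonneg:
  assumes "pos_semidef A" and "h \<in> range ((*v) A)"
  shows "0 \<le> qform (mp_inverse A) h"
  using mp_form_lower [OF assms, of 0] by (simp add: qform_eq_inner)

lemma norm_matrix_vector_mult_le:
  fixes A :: "complex ^ 'n ^ 'm"
  shows "norm (A *v x) \<le> norm A * norm x"
proof -
  have "norm ((A *v x) $ i) \<le> norm (A $ i) * norm x" for i
  proof -
    have "norm ((A *v x) $ i) \<le> (\<Sum>j\<in>UNIV. norm (A $ i $ j) * norm (x $ j))"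
      by (simp add: matrix_vector_mult_def norm_mult sum_norm_le)
    also have "\<dots> \<le> norm (A $ i) * norm x"
      using L2_set_mult_ineq [of "\<lambda>j. norm (A $ i $ j)" "\<lambda>j. norm (x $ j)" UNIV]
      by (simp add: norm_vec_def)
    finally show ?thesis .
  qed
  then have "norm (A *v x) \<le> L2_set (\<lambda>i. norm (A $ i) * norm x) UNIV"
    unfolding norm_vec_def [of "A *v x"] by (intro L2_set_mono) auto
  also have "\<dots> = norm A * norm x"
    by (simp add: norm_vec_def [of A] L2_set_left_distrib)
  finally show ?thesis .
qed

text \<open>Testing with \<open>u = h / \<parallel>A\<parallel>\<close> gives \<open>\<parallel>h\<parallel>\<^sup>2 \<le> \<parallel>A\<parallel> h\<^sup>* A\<^sup>+ h\<close>. The product is split by the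
  inequality of arithmetic and geometric means with a free weight \<open>c\<close>, so that the bound can be
  integrated term by term; a suitable choice of \<open>c\<close> replaces the Cauchy-Schwarz inequality for
  integrals.\<close>

lemma norm_le_mp_form:
  assumes "pos_semidef A" and "h \<in> range ((*v) A)" and "0 < c"
  shows "norm h \<le> (c * norm A + qform (mp_inverse A) h / c) / 2"
proof (cases "norm A = 0")
  case True
  then have "h = 0"
    using assms(2) by auto
  then show ?thesis
    using True mp_form_nonneg [OF assms(1,2)] assms(3) by simp
next
  case False
  then have A: "0 < norm A"
    by simp
  define r where "r = norm A"
  define n where "n = norm h"
  define Q where "Q = qform (mp_inverse A) h"
  have r: "0 < r" using A by (simp add: r_def)
  have q: "qform A h \<le> r * n\<^sup>2"
  proof -
    have "qform A h \<le> norm h * norm (A *v h)"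
      by (simp add: qform_eq_inner norm_cauchy_schwarz)
    also have "\<dots> \<le> norm h * (norm A * norm h)"
      by (intro mult_left_mono norm_matrix_vector_mult_le) simp
    finally show ?thesis
      by (simp add: r_def n_def power2_eq_square mult_ac)
  qed
  \<comment> \<open>The test vector \<open>h / r\<close> maximises \<open>2 (h \<bullet> u) - r \<parallel>u\<parallel>\<^sup>2\<close>, a lower bound for \<open>2 (h \<bullet> u) - u\<^sup>* A u\<close>.\<close>
  have "2 * inner h ((1 / r) *\<^sub>R h) - qform A ((1 / r) *\<^sub>R h) \<le> Q"
    unfolding Q_def using assms(1,2) by (rule mp_form_lower)
  then have "2 * n\<^sup>2 / r - (1 / r)\<^sup>2 * qform A h \<le> Q"
    by (simp add: qform_scaleR n_def power2_norm_eq_inner)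
  moreover have "(1 / r)\<^sup>2 * qform A h \<le> n\<^sup>2 / r"
    using mult_left_mono [OF q, of "(1 / r)\<^sup>2"] r by (simp add: power2_eq_square)
  ultimately have Q: "n\<^sup>2 / r \<le> Q"
    by simp
  have "0 \<le> (c * r - n)\<^sup>2 / (c * r)"
    using assms(3) r by simp
  also have "\<dots> = c * r - 2 * n + n\<^sup>2 / r / c"
    using assms(3) r by (simp add: field_simps power2_eq_square)
  also have "\<dots> \<le> c * r - 2 * n + Q / c"
    using divide_right_mono [OF Q, of c] assms(3) by simp
  finally show ?thesis
    by (simp add: r_def n_def Q_def)
qed

section \<open>Fast Cauchy sequences of integrable functions\<close>

text \<open>The increments are summable in \<open>L\<^sup>1\<close>, hence almost everywhere absolutely summable, and
  \<open>\<parallel>f\<^sub>0\<parallel> + \<Sum>\<^sub>n \<parallel>f\<^sub>n\<^sub>+\<^sub>1 - f\<^sub>n\<parallel>\<close> dominates the sequence. This is the only form of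
  completeness that the existence of an extremal function requires.\<close>

lemma convergent_AE_dominated:
  fixes f :: "nat \<Rightarrow> 'a \<Rightarrow> 'b::{banach, second_countable_topology}"
  assumes int: "\<And>n. integrable M (f n)"
    and step: "\<And>n. (\<integral>x. norm (f (Suc n) x - f n x) \<partial>M) \<le> r n"
    and r: "summable r"
  obtains w where "integrable M w"
    and "AE x in M. convergent (\<lambda>n. f n x) \<and> (\<forall>n. norm (f n x) \<le> w x)"
proof -
  define a where "a n x = norm (f (Suc n) x - f n x)" for n x
  have a_int: "integrable M (a n)" for n
    unfolding a_def by (intro integrable_norm Bochner_Integration.integrable_diff int)
  have a_nonneg: "0 \<le> a n x" for n x
    by (simp add: a_def)
  have sum_int: "summable (\<lambda>n. \<integral>x. a n x \<partial>M)"
  proof (rule summable_comparison_test' [of r 0])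
    show "norm (\<integral>x. a n x \<partial>M) \<le> r n" for n
      using step [of n] by (simp add: a_def integral_nonneg_AE)
  qed (rule r)
  have "(\<integral>\<^sup>+x. (\<Sum>n. ennreal (a n x)) \<partial>M) = (\<Sum>n. \<integral>\<^sup>+x. ennreal (a n x) \<partial>M)"
    using a_int by (intro nn_integral_suminf) (auto dest: borel_measurable_integrable)
  also have "\<dots> = (\<Sum>n. ennreal (\<integral>x. a n x \<partial>M))"
    using a_int a_nonneg by (simp add: nn_integral_eq_integral)
  also have "\<dots> \<noteq> \<infinity>"
    using ennreal_suminf_neq_top [OF sum_int Bochner_Integration.integral_nonneg [OF a_nonneg]]
    by (simp only: infinity_ennreal_def not_False_eq_True)
  finally have "AE x in M. (\<Sum>n. ennreal (a n x)) \<noteq> \<infinity>"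
    using a_int by (intro nn_integral_PInf_AE) (auto dest: borel_measurable_integrable)
  then have sum_AE: "AE x in M. summable (\<lambda>n. a n x)"
    by (rule eventually_mono) (auto intro: summable_suminf_not_top a_nonneg)
  define w where "w x = norm (f 0 x) + (\<Sum>n. a n x)" for x
  have "integrable M w"
    unfolding w_def using sum_AE sum_int a_nonneg a_int int
    by (intro Bochner_Integration.integrable_add integrable_norm integrable_suminf) auto
  moreover have "AE x in M. convergent (\<lambda>n. f n x) \<and> (\<forall>n. norm (f n x) \<le> w x)"
    using sum_AE
  proof (rule eventually_mono)
    fix x
    assume sum: "summable (\<lambda>n. a n x)"
    have tele: "f n x = f 0 x + (\<Sum>i<n. f (Suc i) x - f i x)" for n
      by (simp add: sum_lessThan_telescope [of "\<lambda>i. f i x"])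
    have "summable (\<lambda>n. f (Suc n) x - f n x)"
      using sum unfolding a_def by (rule summable_norm_cancel)
    then have "convergent (\<lambda>n. \<Sum>i<n. f (Suc i) x - f i x)"
      by (simp add: summable_iff_convergent)
    then have "convergent (\<lambda>n. f 0 x + (\<Sum>i<n. f (Suc i) x - f i x))"
      by (simp add: convergent_add_const_iff)
    then have "convergent (\<lambda>n. f n x)"
      by (simp only: tele [symmetric])
    moreover have "norm (f n x) \<le> w x" for n
    proof -
      have "norm (f n x) \<le> norm (f 0 x) + norm (\<Sum>i<n. f (Suc i) x - f i x)"
        by (subst tele) (rule norm_triangle_ineq)
      also have "norm (\<Sum>i<n. f (Suc i) x - f i x) \<le> (\<Sum>i<n. a i x)"
        unfolding a_def by (rule norm_sum)
      also have "\<dots> \<le> (\<Sum>n. a n x)"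
        using sum a_nonneg by (intro sum_le_suminf) auto
      finally show ?thesis
        by (simp add: w_def)
    qed
    ultimately show "convergent (\<lambda>n. f n x) \<and> (\<forall>n. norm (f n x) \<le> w x)"
      by blast
  qed
  ultimately show thesis ..
qed

section \<open>Bounded measurable vector functions\<close>

text \<open>Trigonometric polynomials enter the extremal problem only through boundedness and
  measurability; these make all integrals against the integrable weight finite.\<close>

definition bounded_measurable :: "'a measure \<Rightarrow> ('a \<Rightarrow> complex ^ 'n) set" where
  "bounded_measurable M =
     {f \<in> borel_measurable M. \<exists>K. \<forall>x\<in>space M. norm (f x) \<le> K}"

lemma bounded_measurable_measurable:
  "f \<in> bounded_measurable M \<Longrightarrow> f \<in> borel_measurable M"
  by (simp add: bounded_measurable_def)

lemma bounded_measurable_bound: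
  assumes "f \<in> bounded_measurable M"
  obtains K where "0 \<le> K" and "\<And>x. x \<in> space M \<Longrightarrow> norm (f x) \<le> K"
proof -
  obtain K where K: "\<And>x. x \<in> space M \<Longrightarrow> norm (f x) \<le> K"
    using assms by (auto simp: bounded_measurable_def)
  show thesis
    by (rule that [of "\<bar>K\<bar>"]) (use K in force)+
qed

lemma bounded_measurable_diff_scaleR:
  assumes f: "f \<in> bounded_measurable M" and g: "g \<in> bounded_measurable M"
  shows "(\<lambda>x. f x - c *\<^sub>R g x) \<in> bounded_measurable M"
proof -
  obtain K where K: "\<And>x. x \<in> space M \<Longrightarrow> norm (f x) \<le> K"
    using bounded_measurable_bound [OF f] by blast
  obtain L where L: "\<And>x. x \<in> space M \<Longrightarrow> norm (g x) \<le> L"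
    using bounded_measurable_bound [OF g] by blast
  have "norm (f x - c *\<^sub>R g x) \<le> K + \<bar>c\<bar> * L" if "x \<in> space M" for x
    using norm_triangle_ineq4 [of "f x" "c *\<^sub>R g x"] K [OF that]
      mult_left_mono [OF L [OF that], of "\<bar>c\<bar>"] by simp
  then show ?thesis
    using f g by (auto simp: bounded_measurable_def)
qed

lemma bounded_measurable_diff:
  assumes "f \<in> bounded_measurable M" and "g \<in> bounded_measurable M"
  shows "(\<lambda>x. f x - g x) \<in> bounded_measurable M"
  using bounded_measurable_diff_scaleR [OF assms, of 1] by simp

lemma vector_scalar_mult_measurable:
  fixes f :: "'a \<Rightarrow> complex ^ 'n"
  assumes "c \<in> borel_measurable M" and "f \<in> borel_measurable M"
  shows "(\<lambda>x. c x *s f x) \<in> borel_measurable M"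
proof -
  have "continuous_on UNIV (\<lambda>p :: complex \<times> (complex ^ 'n). fst p *s snd p)"
    unfolding vector_scalar_mult_def by (intro continuous_intros)
  then show ?thesis
    using borel_measurable_continuous_Pair [OF assms, of "(*s)"] by (simp add: case_prod_unfold)
qed

lemma matrix_vector_mult_measurable:
  fixes A :: "'a \<Rightarrow> complex ^ 'n ^ 'n" and f :: "'a \<Rightarrow> complex ^ 'n"
  assumes "A \<in> borel_measurable M" and "f \<in> borel_measurable M"
  shows "(\<lambda>x. A x *v f x) \<in> borel_measurable M"
proof -
  have "continuous_on UNIV (\<lambda>p :: (complex ^ 'n ^ 'n) \<times> (complex ^ 'n). fst p *v snd p)"
    unfolding matrix_vector_mult_def by (intro continuous_intros)
  then show ?thesis
    using borel_measurable_continuous_Pair [OF assms, of "(*v)"] by (simp add: case_prod_unfold)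
qed

lemma norm_vector_scalar_mult: "norm (c *s v) = norm c * norm (v :: complex ^ 'n)"
  by (simp add: norm_vec_def norm_mult L2_set_right_distrib)

lemma vector_scalar_mult_bounded_measurable:
  assumes c: "c \<in> borel_measurable M" and C: "\<And>x. x \<in> space M \<Longrightarrow> norm (c x) \<le> C"
    and f: "f \<in> bounded_measurable M"
  shows "(\<lambda>x. c x *s f x) \<in> bounded_measurable M"
proof -
  obtain K where "\<And>x. x \<in> space M \<Longrightarrow> norm (f x) \<le> K"
    using bounded_measurable_bound [OF f] by blast
  then have "norm (c x *s f x) \<le> C * K" if "x \<in> space M" for x
    using C [OF that] that by (simp add: norm_vector_scalar_mult mult_mono order_trans [OF norm_ge_zero C])
  then show ?thesis
    using vector_scalar_mult_measurable [OF c] f by (auto simp: bounded_measurable_def)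
qed

lemma integrable_inner_bounded:
  assumes h: "integrable M h" and g: "g \<in> bounded_measurable M"
  shows "integrable M (\<lambda>\<gamma>. inner (h \<gamma>) (g \<gamma>))"
proof -
  obtain K where K: "\<And>x. x \<in> space M \<Longrightarrow> norm (g x) \<le> K"
    using bounded_measurable_bound [OF g] by blast
  have bound: "norm (inner (h x) (g x)) \<le> norm (norm (h x) * K)" if "x \<in> space M" for x
  proof -
    have "norm (inner (h x) (g x)) \<le> norm (h x) * norm (g x)"
      by (simp add: Cauchy_Schwarz_ineq2)
    also have "\<dots> \<le> norm (h x) * K"
      using K [OF that] by (rule mult_left_mono) simp
    finally show ?thesis
      by simp
  qed
  show ?thesis
  proof (rule Bochner_Integration.integrable_bound)
    show "integrable M (\<lambda>x. norm (h x) * K)"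
      using h by simp
    show "(\<lambda>x. inner (h x) (g x)) \<in> borel_measurable M"
      using bounded_measurable_measurable [OF g] h by simp
  qed (use bound in \<open>intro AE_I2\<close>)
qed

section \<open>The spaces weighted by a matrix function and by its pseudoinverse\<close>

locale matrix_weight =
  fixes M :: "'a measure" and W :: "'a \<Rightarrow> complex ^ 'q ^ 'q"
  assumes W_integrable: "integrable M W"
    and W_psd: "\<gamma> \<in> space M \<Longrightarrow> pos_semidef (W \<gamma>)"
begin

definition weight_form :: "('a \<Rightarrow> complex ^ 'q) \<Rightarrow> real" where
  "weight_form f = (\<integral>\<gamma>. qform (W \<gamma>) (f \<gamma>) \<partial>M)"

definition weight_inner :: "('a \<Rightarrow> complex ^ 'q) \<Rightarrow> ('a \<Rightarrow> complex ^ 'q) \<Rightarrow> real" where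
  "weight_inner f g = (\<integral>\<gamma>. inner (W \<gamma> *v f \<gamma>) (g \<gamma>) \<partial>M)"

abbreviation mp_form :: "('a \<Rightarrow> complex ^ 'q) \<Rightarrow> 'a \<Rightarrow> real" where
  "mp_form h \<gamma> \<equiv> qform (mp_inverse (W \<gamma>)) (h \<gamma>)"

lemma W_measurable: "W \<in> borel_measurable M"
  using W_integrable by simp

lemma integrable_weight_inner:
  assumes f: "f \<in> bounded_measurable M" and g: "g \<in> bounded_measurable M"
  shows "integrable M (\<lambda>\<gamma>. inner (W \<gamma> *v f \<gamma>) (g \<gamma>))"
proof -
  obtain K where K: "0 \<le> K" "\<And>x. x \<in> space M \<Longrightarrow> norm (f x) \<le> K"
    using bounded_measurable_bound [OF f] by blast
  obtain L where L: "0 \<le> L" "\<And>x. x \<in> space M \<Longrightarrow> norm (g x) \<le> L"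
    using bounded_measurable_bound [OF g] by blast
  have bound: "norm (inner (W x *v f x) (g x)) \<le> norm (norm (W x) * K * L)" if x: "x \<in> space M" for x
  proof -
    have "norm (inner (W x *v f x) (g x)) \<le> norm (W x *v f x) * norm (g x)"
      by (simp add: Cauchy_Schwarz_ineq2)
    also have "\<dots> \<le> (norm (W x) * norm (f x)) * norm (g x)"
      by (intro mult_right_mono norm_matrix_vector_mult_le) simp
    also have "\<dots> \<le> norm (W x) * K * L"
      using K L x by (intro mult_mono) auto
    finally show ?thesis
      by simp
  qed
  show ?thesis
  proof (rule Bochner_Integration.integrable_bound)
    show "integrable M (\<lambda>x. norm (W x) * K * L)"
      using W_integrable by simp
    show "(\<lambda>x. inner (W x *v f x) (g x)) \<in> borel_measurable M"
      by (intro borel_measurable_inner matrix_vector_mult_measurable W_measurable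
          bounded_measurable_measurable f g)
  qed (use bound in \<open>intro AE_I2\<close>)
qed

lemma integrable_weight_form:
  assumes "f \<in> bounded_measurable M"
  shows "integrable M (\<lambda>\<gamma>. qform (W \<gamma>) (f \<gamma>))"
  using integrable_weight_inner [OF assms assms] by (simp add: qform_eq_inner inner_commute)

lemma weight_form_nonneg: "0 \<le> weight_form f"
  unfolding weight_form_def using W_psd by (intro integral_nonneg_AE AE_I2) (simp add: pos_semidef_nonneg)

lemma weight_inner_self: "weight_inner f f = weight_form f"
  by (simp add: weight_inner_def weight_form_def qform_eq_inner inner_commute)

lemma weight_inner_diff_right:
  assumes "f \<in> bounded_measurable M" "g \<in> bounded_measurable M" "k \<in> bounded_measurable M"
  shows "weight_inner f (\<lambda>\<gamma>. g \<gamma> - k \<gamma>) = weight_inner f g - weight_inner f k"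
  using assms by (simp add: weight_inner_def inner_diff_right Bochner_Integration.integral_diff integrable_weight_inner)

lemma weight_form_diff_scaleR:
  assumes f: "f \<in> bounded_measurable M" and g: "g \<in> bounded_measurable M"
  shows "weight_form (\<lambda>\<gamma>. f \<gamma> - c *\<^sub>R g \<gamma>) = weight_form f - 2 * c * weight_inner f g + c\<^sup>2 * weight_form g"
proof -
  have "weight_form (\<lambda>\<gamma>. f \<gamma> - c *\<^sub>R g \<gamma>) =
      (\<integral>\<gamma>. qform (W \<gamma>) (f \<gamma>) - 2 * c * inner (W \<gamma> *v f \<gamma>) (g \<gamma>)
        + c\<^sup>2 * qform (W \<gamma>) (g \<gamma>) \<partial>M)"
    unfolding weight_form_def
    by (rule Bochner_Integration.integral_cong)
       (simp_all add: qform_diff qform_scaleR pos_semidef_adj W_psd)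
  then show ?thesis
    using integrable_weight_form [OF f] integrable_weight_form [OF g] integrable_weight_inner [OF f g]
    by (simp add: weight_form_def weight_inner_def)
qed

text \<open>The form is the supremum over \<open>u\<close> of \<open>2 (h \<bullet> u) - u\<^sup>* W u\<close>, which is plainly measurable for fixed \<open>u\<close>
  and continuous in \<open>u\<close>; so a countable dense set of vectors \<open>u\<close> suffices.\<close>

lemma mp_form_measurable:
  assumes h: "h \<in> borel_measurable M" and ran: "\<And>\<gamma>. \<gamma> \<in> space M \<Longrightarrow> h \<gamma> \<in> range ((*v) (W \<gamma>))"
  shows "mp_form h \<in> borel_measurable M"
proof -
  obtain D :: "(complex ^ 'q) set" where D: "countable D"
    and dense: "\<And>X. open X \<Longrightarrow> X \<noteq> {} \<Longrightarrow> \<exists>d\<in>D. d \<in> X"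
    by (rule countable_dense_setE) blast
  define q where "q u \<gamma> = 2 * inner (h \<gamma>) u - qform (W \<gamma>) u" for u \<gamma>
  have q_meas: "q u \<in> borel_measurable M" for u
    unfolding q_def qform_eq_inner
    using h matrix_vector_mult_measurable [OF W_measurable borel_measurable_const] by measurable
  have "{\<gamma> \<in> space M. a < mp_form h \<gamma>} \<in> sets M" for a
  proof -
    have "{\<gamma> \<in> space M. a < mp_form h \<gamma>} = (\<Union>u\<in>D. {\<gamma> \<in> space M. a < q u \<gamma>})"
    proof (intro equalityI subsetI)
      fix \<gamma>
      assume "\<gamma> \<in> {\<gamma> \<in> space M. a < mp_form h \<gamma>}"
      then have \<gamma>: "\<gamma> \<in> space M" "a < mp_form h \<gamma>"
        by auto
      then obtain u where u: "a < q u \<gamma>"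
        using mp_form_attained [OF W_psd ran] unfolding q_def by metis
      have "continuous_on UNIV (\<lambda>u. q u \<gamma>)"
        unfolding q_def qform_eq_inner
        by (intro continuous_intros linear_continuous_on) (simp add: matrix_vector_mul_bounded_linear)
      then have "open {u. a < q u \<gamma>}"
        by (intro open_Collect_less continuous_on_const)
      then show "\<gamma> \<in> (\<Union>u\<in>D. {\<gamma> \<in> space M. a < q u \<gamma>})"
        using dense u \<gamma>(1) by blast
    next
      fix \<gamma>
      assume "\<gamma> \<in> (\<Union>u\<in>D. {\<gamma> \<in> space M. a < q u \<gamma>})"
      then show "\<gamma> \<in> {\<gamma> \<in> space M. a < mp_form h \<gamma>}"
        using mp_form_lower [OF W_psd ran] unfolding q_def by (auto intro: less_le_trans)
    qed
    also have "\<dots> \<in> sets M"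
      using D q_meas by (intro sets.countable_UN') auto
    finally show ?thesis .
  qed
  then show ?thesis
    by (simp add: borel_measurable_iff_greater)
qed

lemma L2_mp_measurable: "h \<in> L2_mp M W \<Longrightarrow> h \<in> borel_measurable M"
  by (simp add: L2_mp_def)

lemma L2_mp_range: "h \<in> L2_mp M W \<Longrightarrow> \<gamma> \<in> space M \<Longrightarrow> h \<gamma> \<in> range ((*v) (W \<gamma>))"
  by (simp add: L2_mp_def)

lemma L2_mp_form_nonneg: "h \<in> L2_mp M W \<Longrightarrow> \<gamma> \<in> space M \<Longrightarrow> 0 \<le> mp_form h \<gamma>"
  by (intro mp_form_nonneg W_psd L2_mp_range)

lemma integrable_mp_form:
  assumes "h \<in> L2_mp M W"
  shows "integrable M (mp_form h)"
  using assms mp_form_measurable L2_mp_form_nonneg [OF assms]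
  by (intro integrableI_nonneg AE_I2) (auto simp: L2_mp_def)

lemma integrable_L2_mp:
  assumes h: "h \<in> L2_mp M W"
  shows "integrable M h"
proof -
  have bound: "norm (h x) \<le> norm ((norm (W x) + mp_form h x) / 2)" if "x \<in> space M" for x
    using norm_le_mp_form [OF W_psd [OF that] L2_mp_range [OF h that], of 1] by simp
  show ?thesis
  proof (rule Bochner_Integration.integrable_bound)
    show "integrable M (\<lambda>x. (norm (W x) + mp_form h x) / 2)"
      using integrable_mp_form [OF h] W_integrable by simp
  qed (use bound L2_mp_measurable [OF h] in \<open>simp_all add: AE_I2\<close>)
qed

text \<open>The Cauchy-Schwarz inequality for the pairing of \<open>L\<^sup>2(W\<^sup>+)\<close> with \<open>L\<^sup>2(W)\<close>. Integrating the
  pointwise bound with \<open>u = c g\<close> gives \<open>2 c - c\<^sup>2 \<integral> g\<^sup>* W g \<le> \<integral> h\<^sup>* W\<^sup>+ h\<close> for every real \<open>c\<close>.\<close>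

lemma L2_mp_pairing_bound:
  assumes h: "h \<in> L2_mp M W" and g: "g \<in> bounded_measurable M"
    and one: "(\<integral>\<gamma>. inner (h \<gamma>) (g \<gamma>) \<partial>M) = 1"
  shows "1 \<le> (\<integral>\<gamma>. mp_form h \<gamma> \<partial>M) * weight_form g"
proof -
  define P where "P = (\<integral>\<gamma>. mp_form h \<gamma> \<partial>M)"
  have hg: "integrable M (\<lambda>\<gamma>. inner (h \<gamma>) (g \<gamma>))"
    using integrable_L2_mp [OF h] g by (rule integrable_inner_bounded)
  have *: "2 * c - c\<^sup>2 * weight_form g \<le> P" for c
  proof -
    have "2 * c * inner (h \<gamma>) (g \<gamma>) - c\<^sup>2 * qform (W \<gamma>) (g \<gamma>) \<le> mp_form h \<gamma>"
      if "\<gamma> \<in> space M" for \<gamma>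
      using mp_form_lower [OF W_psd L2_mp_range [OF h], OF that that, of "c *\<^sub>R g \<gamma>"]
      by (simp add: qform_scaleR mult.assoc)
    then have "(\<integral>\<gamma>. 2 * c * inner (h \<gamma>) (g \<gamma>) - c\<^sup>2 * qform (W \<gamma>) (g \<gamma>) \<partial>M) \<le> P"
      unfolding P_def
      using hg integrable_weight_form [OF g] integrable_mp_form [OF h]
      by (intro integral_mono) auto
    then show ?thesis
      using hg integrable_weight_form [OF g] by (simp add: weight_form_def one)
  qed
  have "weight_form g \<noteq> 0"
    using * [of "P + 1"] * [of 0] by auto
  then have "0 < weight_form g"
    using weight_form_nonneg [of g] by simp
  then show ?thesis
    using * [of "1 / weight_form g"] by (simp add: P_def field_simps power2_eq_square)
qed

text \<open>Multiplication by \<open>W\<close> is an isometry from \<open>L\<^sup>2(W)\<close> into \<open>L\<^sup>2(W\<^sup>+)\<close>.\<close>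

lemma weight_mult_L2_mp:
  assumes f: "f \<in> bounded_measurable M"
  shows "(\<lambda>\<gamma>. W \<gamma> *v f \<gamma>) \<in> L2_mp M W"
    and "\<gamma> \<in> space M \<Longrightarrow> mp_form (\<lambda>\<gamma>. W \<gamma> *v f \<gamma>) \<gamma> = qform (W \<gamma>) (f \<gamma>)"
proof -
  show eq: "mp_form (\<lambda>\<gamma>. W \<gamma> *v f \<gamma>) \<gamma> = qform (W \<gamma>) (f \<gamma>)" if "\<gamma> \<in> space M" for \<gamma>
    using W_psd [OF that] by (simp add: qform_mp_inverse pos_semidef_adj)
  have "(\<integral>\<^sup>+ \<gamma>. ennreal (mp_form (\<lambda>\<gamma>. W \<gamma> *v f \<gamma>) \<gamma>) \<partial>M) =
      (\<integral>\<^sup>+ \<gamma>. ennreal (qform (W \<gamma>) (f \<gamma>)) \<partial>M)"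
    by (intro nn_integral_cong) (simp only: eq)
  also have "\<dots> < \<infinity>"
    using integrable_weight_form [OF f] W_psd
    by (subst nn_integral_eq_integral) (auto simp: pos_semidef_nonneg)
  finally show "(\<lambda>\<gamma>. W \<gamma> *v f \<gamma>) \<in> L2_mp M W"
    using matrix_vector_mult_measurable [OF W_measurable bounded_measurable_measurable [OF f]]
    by (simp add: L2_mp_def)
qed

lemma norm_weight_mult_integral:
  assumes f: "f \<in> bounded_measurable M" and c: "0 < c"
  shows "(\<integral>\<gamma>. norm (W \<gamma> *v f \<gamma>) \<partial>M) \<le> (c * (\<integral>\<gamma>. norm (W \<gamma>) \<partial>M) + weight_form f / c) / 2"
proof -
  have "norm (W \<gamma> *v f \<gamma>) \<le> (c * norm (W \<gamma>) + qform (W \<gamma>) (f \<gamma>) / c) / 2" if "\<gamma> \<in> space M" for \<gamma>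
    using norm_le_mp_form [OF W_psd [OF that] rangeI c, of "f \<gamma>"] weight_mult_L2_mp(2) [OF f that]
    by simp
  then have "(\<integral>\<gamma>. norm (W \<gamma> *v f \<gamma>) \<partial>M)
      \<le> (\<integral>\<gamma>. (c * norm (W \<gamma>) + qform (W \<gamma>) (f \<gamma>) / c) / 2 \<partial>M)"
    using integrable_L2_mp [OF weight_mult_L2_mp(1) [OF f]] W_integrable integrable_weight_form [OF f]
    by (intro integral_mono) auto
  also have "\<dots> = (c * (\<integral>\<gamma>. norm (W \<gamma>) \<partial>M) + weight_form f / c) / 2"
    using W_integrable integrable_weight_form [OF f] by (simp add: weight_form_def)
  finally show ?thesis .
qed

text \<open>As a maximum of functions affine in \<open>h\<close>, the form \<open>h\<^sup>* W\<^sup>+ h\<close> is lower semicontinuous on the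
  range of \<open>W\<close>, which is closed; Fatou's lemma does the rest.\<close>

lemma L2_mp_Fatou:
  assumes v: "\<And>n. v n \<in> L2_mp M W"
    and lim: "\<And>\<gamma>. \<gamma> \<in> space M \<Longrightarrow> (\<lambda>n. v n \<gamma>) \<longlonglongrightarrow> h \<gamma>"
    and r: "(\<lambda>n. \<integral>\<gamma>. mp_form (v n) \<gamma> \<partial>M) \<longlonglongrightarrow> r"
  shows "h \<in> L2_mp M W" and "(\<integral>\<gamma>. mp_form h \<gamma> \<partial>M) \<le> r"
proof -
  have meas: "h \<in> borel_measurable M"
    using L2_mp_measurable [OF v] lim by (rule borel_measurable_LIMSEQ_metric)
  have ran: "h \<gamma> \<in> range ((*v) (W \<gamma>))" if "\<gamma> \<in> space M" for \<gamma>
  proof -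
    have "subspace (range ((*v) (W \<gamma>)))"
      using linear_subspace_image [OF matrix_vector_mul_linear subspace_UNIV] .
    then have "closed (range ((*v) (W \<gamma>)))"
      by (rule closed_subspace)
    then show ?thesis
      using L2_mp_range [OF v that] lim [OF that] by (rule closed_sequentially)
  qed
  have le: "ennreal (mp_form h \<gamma>) \<le> liminf (\<lambda>n. ennreal (mp_form (v n) \<gamma>))"
    if \<gamma>: "\<gamma> \<in> space M" for \<gamma>
  proof -
    obtain u where u: "2 * inner (h \<gamma>) u - qform (W \<gamma>) u = mp_form h \<gamma>"
      using mp_form_attained [OF W_psd ran] \<gamma> by metis
    have "(\<lambda>n. 2 * inner (v n \<gamma>) u - qform (W \<gamma>) u) \<longlonglongrightarrow> mp_form h \<gamma>"
      unfolding u [symmetric] by (intro tendsto_intros lim \<gamma>)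
    then have "(\<lambda>n. ennreal (2 * inner (v n \<gamma>) u - qform (W \<gamma>) u)) \<longlonglongrightarrow> ennreal (mp_form h \<gamma>)"
      by (rule tendsto_ennrealI)
    then have "ennreal (mp_form h \<gamma>) = liminf (\<lambda>n. ennreal (2 * inner (v n \<gamma>) u - qform (W \<gamma>) u))"
      by (simp add: lim_imp_Liminf)
    also have "\<dots> \<le> liminf (\<lambda>n. ennreal (mp_form (v n) \<gamma>))"
      using mp_form_lower [OF W_psd L2_mp_range [OF v]] \<gamma>
      by (intro Liminf_mono always_eventually allI ennreal_leI) auto
    finally show ?thesis .
  qed
  have "(\<integral>\<^sup>+\<gamma>. ennreal (mp_form h \<gamma>) \<partial>M) \<le> (\<integral>\<^sup>+\<gamma>. liminf (\<lambda>n. ennreal (mp_form (v n) \<gamma>)) \<partial>M)"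
    using le by (rule nn_integral_mono)
  also have "\<dots> \<le> liminf (\<lambda>n. \<integral>\<^sup>+\<gamma>. ennreal (mp_form (v n) \<gamma>) \<partial>M)"
    using integrable_mp_form [OF v] by (intro nn_integral_liminf) (auto dest: borel_measurable_integrable)
  also have "\<dots> = liminf (\<lambda>n. ennreal (\<integral>\<gamma>. mp_form (v n) \<gamma> \<partial>M))"
    using integrable_mp_form [OF v] L2_mp_form_nonneg [OF v] by (simp add: nn_integral_eq_integral)
  also have "\<dots> = ennreal r"
    using tendsto_ennrealI [OF r] by (simp add: lim_imp_Liminf)
  finally have bound: "(\<integral>\<^sup>+\<gamma>. ennreal (mp_form h \<gamma>) \<partial>M) \<le> ennreal r" .
  then have "(\<integral>\<^sup>+\<gamma>. ennreal (mp_form h \<gamma>) \<partial>M) < \<infinity>"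
    using le_less_trans ennreal_less_top by fastforce
  then show L2: "h \<in> L2_mp M W"
    using meas ran by (simp add: L2_mp_def)
  have "0 \<le> r"
    using r L2_mp_form_nonneg [OF v]
    by (intro LIMSEQ_le_const [OF r]) (auto intro!: integral_nonneg_AE AE_I2)
  then show "(\<integral>\<gamma>. mp_form h \<gamma> \<partial>M) \<le> r"
    using bound integrable_mp_form [OF L2] L2_mp_form_nonneg [OF L2]
    by (simp add: nn_integral_eq_integral)
qed

end

section \<open>Minimising sequences\<close>

lemma square_le_of_quadratic_nonneg:
  fixes a b n :: real
  assumes nonneg: "\<And>c. 0 \<le> a - 2 * c * b + c\<^sup>2 * n" and "0 \<le> n"
  shows "b\<^sup>2 \<le> a * n"
proof (cases "n = 0")
  case True
  have "b = 0"
  proof (rule ccontr)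
    assume "b \<noteq> 0"
    then show False
      using nonneg [of "(a + 1) / (2 * b)"] True by simp
  qed
  then show ?thesis
    using True by simp
next
  case False
  then have "0 < n"
    using assms(2) by simp
  then have "0 \<le> (a - 2 * (b / n) * b + (b / n)\<^sup>2 * n) * n"
    using nonneg [of "b / n"] by simp
  then show ?thesis
    using \<open>0 < n\<close> by (simp add: field_simps power2_eq_square)
qed

lemma inner_imaginary_scale:
  fixes x y :: "complex ^ 'n"
  shows "inner (\<i> *s x) y = - inner x (\<i> *s y)"
  by (simp add: inner_vec_def inner_complex_def sum_negf [symmetric] algebra_simps)

lemma matrix_vector_mult_scale:
  fixes A :: "complex ^ 'n ^ 'n"
  shows "A *v (c *s v) = c *s (A *v v)"
  by (simp add: matrix_vector_mult_def vec_eq_iff sum_distrib_left mult_ac)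

text \<open>That is, \<open>v\<^sup>* A v\<close> is real.\<close>

lemma hermitian_inner_imaginary:
  fixes A :: "complex ^ 'n ^ 'n"
  assumes "mat_adj A = A"
  shows "inner (A *v v) (\<i> *s v) = 0"
proof -
  have "inner (A *v v) (\<i> *s v) = inner v (\<i> *s (A *v v))"
    by (metis assms inner_mat_adj matrix_vector_mult_scale)
  also have "\<dots> = - inner (A *v v) (\<i> *s v)"
    by (metis inner_commute inner_imaginary_scale)
  finally show ?thesis
    by simp
qed

lemma qform_imaginary_scale: "qform A (\<i> *s v) = qform A v"
proof -
  have "\<i> *s (\<i> *s (A *v v)) = - (A *v v)"
    by (simp add: vec_eq_iff)
  then show ?thesis
    by (simp add: qform_eq_inner matrix_vector_mult_scale inner_imaginary_scale)
qed

context matrix_weight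
begin

lemma mp_form_scaleR: "mp_form (\<lambda>\<gamma>. c *\<^sub>R h \<gamma>) \<gamma> = c\<^sup>2 * mp_form h \<gamma>"
  by (rule qform_scaleR)

lemma L2_mp_scaleR:
  assumes h: "h \<in> L2_mp M W"
  shows "(\<lambda>\<gamma>. c *\<^sub>R h \<gamma>) \<in> L2_mp M W"
proof -
  have "c *\<^sub>R h \<gamma> \<in> range ((*v) (W \<gamma>))" if "\<gamma> \<in> space M" for \<gamma>
    using L2_mp_range [OF h that] linear_subspace_image [OF matrix_vector_mul_linear subspace_UNIV]
    by (rule subspace_scale [rotated])
  moreover have "integrable M (mp_form (\<lambda>\<gamma>. c *\<^sub>R h \<gamma>))"
    unfolding mp_form_scaleR using integrable_mp_form [OF h] by simp
  then have "(\<integral>\<^sup>+\<gamma>. ennreal (mp_form (\<lambda>\<gamma>. c *\<^sub>R h \<gamma>) \<gamma>) \<partial>M) < \<infinity>"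
    using L2_mp_form_nonneg [OF h]
    by (subst nn_integral_eq_integral) (auto simp: mp_form_scaleR)
  ultimately show ?thesis
    using L2_mp_measurable [OF h] by (simp add: L2_mp_def)
qed

text \<open>Let \<open>f\<close> have nearly minimal form among its translates by multiples of \<open>u\<close>. The quadratic
  polynomial \<open>c \<mapsto> weight_form (f - c u) - D\<close> is then nonnegative. That its discriminant is not
  positive says that \<open>f\<close> is nearly orthogonal to \<open>u\<close>; its value at \<open>c = 1/2\<close> gives the
  parallelogram argument, by which two near minimisers are close to each other.\<close>

lemma almost_minimal_difference:
  assumes f: "f \<in> bounded_measurable M" and u: "u \<in> bounded_measurable M"
    and D: "\<And>c. D \<le> weight_form (\<lambda>\<gamma>. f \<gamma> - c *\<^sub>R u \<gamma>)"
    and e: "weight_form f \<le> D + e"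
  shows "(weight_inner f u)\<^sup>2 \<le> e * weight_form u"
    and "weight_form (\<lambda>\<gamma>. f \<gamma> - u \<gamma>) \<le> D + e' \<Longrightarrow> weight_form u \<le> 2 * (e + e')"
proof -
  have D': "D \<le> weight_form f - 2 * c * weight_inner f u + c\<^sup>2 * weight_form u" for c
    using D [of c] by (simp add: weight_form_diff_scaleR [OF f u])
  show "(weight_inner f u)\<^sup>2 \<le> e * weight_form u"
  proof (rule square_le_of_quadratic_nonneg)
    show "0 \<le> e - 2 * c * weight_inner f u + c\<^sup>2 * weight_form u" for c
      using D' [of c] e by linarith
  qed (rule weight_form_nonneg)
  show "weight_form u \<le> 2 * (e + e')" if "weight_form (\<lambda>\<gamma>. f \<gamma> - u \<gamma>) \<le> D + e'"
    \<comment> \<open>Twice the inequality \<open>D \<le> weight_form (f - u/2)\<close> eliminates the pairing of \<open>f\<close> with \<open>u\<close> against \<open>weight_form (f - u)\<close>.\<close>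
    using D' [of "1 / 2"] that e weight_form_diff_scaleR [OF f u, of 1]
    by (simp add: power2_eq_square)
qed

text \<open>A sequence that is Cauchy in \<open>L\<^sup>2(W)\<close> at a geometric rate has images \<open>W f\<^sub>n\<close> that are Cauchy in
  \<open>L\<^sup>1\<close>, so the limit \<open>h\<close> of the images is found as a dominated pointwise limit, and no limit in
  \<open>L\<^sup>2(W)\<close> is needed. Fatou's lemma bounds the form of \<open>h\<close>, dominated convergence its pairings.\<close>

lemma weight_image_limit:
  assumes f: "\<And>n. f n \<in> bounded_measurable M"
    and steps: "\<And>n. weight_form (\<lambda>\<gamma>. f n \<gamma> - f (Suc n) \<gamma>) \<le> C * (1 / 4) ^ n"
    and D: "(\<lambda>n. weight_form (f n)) \<longlonglongrightarrow> D"
  obtains h where "h \<in> L2_mp M W" and "(\<integral>\<gamma>. mp_form h \<gamma> \<partial>M) \<le> D"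
    and "\<And>p. p \<in> bounded_measurable M \<Longrightarrow>
           (\<lambda>n. weight_inner (f n) p) \<longlonglongrightarrow> (\<integral>\<gamma>. inner (h \<gamma>) (p \<gamma>) \<partial>M)"
proof -
  define g where "g n \<gamma> = W \<gamma> *v f n \<gamma>" for n \<gamma>
  have g_L2: "g n \<in> L2_mp M W" for n
    unfolding g_def using f by (rule weight_mult_L2_mp)
  define A where "A = (\<integral>\<gamma>. norm (W \<gamma>) \<partial>M)"
  have step: "(\<integral>\<gamma>. norm (g (Suc n) \<gamma> - g n \<gamma>) \<partial>M) \<le> (A + C) / 2 * (1 / 2) ^ n" for n
  proof -
    \<comment> \<open>The weight \<open>c = 2\<^sup>-\<^sup>n\<close> balances the two terms of the bound.\<close>
    have "(\<integral>\<gamma>. norm (g (Suc n) \<gamma> - g n \<gamma>) \<partial>M) = (\<integral>\<gamma>. norm (W \<gamma> *v (f n \<gamma> - f (Suc n) \<gamma>)) \<partial>M)"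
      by (simp add: g_def norm_minus_commute matrix_vector_mult_diff_distrib)
    also have "\<dots> \<le> ((1 / 2) ^ n * A + weight_form (\<lambda>\<gamma>. f n \<gamma> - f (Suc n) \<gamma>) / (1 / 2) ^ n) / 2"
      unfolding A_def using bounded_measurable_diff [OF f f]
      by (rule norm_weight_mult_integral) simp
    also have "\<dots> \<le> ((1 / 2) ^ n * A + C * (1 / 4) ^ n / (1 / 2) ^ n) / 2"
      by (intro divide_right_mono add_left_mono steps) auto
    also have "(1 / 4 :: real) ^ n = (1 / 2) ^ n * (1 / 2) ^ n"
      by (simp flip: power_mult_distrib)
    finally show ?thesis
      by (simp add: algebra_simps)
  qed
  have "summable (\<lambda>n. (A + C) / 2 * (1 / 2 :: real) ^ n)"
    by (intro summable_mult summable_geometric) simp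
  with integrable_L2_mp [OF g_L2] step
  obtain w where w: "integrable M w"
    and AE: "AE \<gamma> in M. convergent (\<lambda>n. g n \<gamma>) \<and> (\<forall>n. norm (g n \<gamma>) \<le> w \<gamma>)"
    by (rule convergent_AE_dominated)
  obtain Z where Z: "Z \<in> null_sets M"
    and off_Z: "{\<gamma> \<in> space M. \<not> (convergent (\<lambda>n. g n \<gamma>) \<and> (\<forall>n. norm (g n \<gamma>) \<le> w \<gamma>))} \<subseteq> Z"
    using AE unfolding eventually_ae_filter by blast
  \<comment> \<open>The sequence is cut off on the exceptional null set, so that its limit exists and lies in the range of \<open>W\<close> at every point.\<close>
  define v where "v n \<gamma> = indicator (- Z) \<gamma> *\<^sub>R g n \<gamma>" for n \<gamma>
  define h where "h \<gamma> = lim (\<lambda>n. v n \<gamma>)" for \<gamma>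
  have AE_v: "AE \<gamma> in M. \<forall>n. v n \<gamma> = g n \<gamma>"
    using AE_not_in [OF Z] by (rule eventually_mono) (simp add: v_def)
  have v_meas: "v n \<in> borel_measurable M" for n
  proof -
    have "(\<lambda>\<gamma>. indicator (- Z) \<gamma> :: real) = (\<lambda>\<gamma>. 1 - indicator Z \<gamma>)"
      by (auto simp: indicator_def)
    then have "(\<lambda>\<gamma>. indicator (- Z) \<gamma> :: real) \<in> borel_measurable M"
      using null_setsD2 [OF Z] by simp
    then show ?thesis
      unfolding v_def using L2_mp_measurable [OF g_L2] by simp
  qed
  have v_form: "mp_form (v n) \<gamma> = indicator (- Z) \<gamma> * mp_form (g n) \<gamma>" for n \<gamma>
    by (simp add: v_def qform_scaleR indicator_def)
  have v_L2: "v n \<in> L2_mp M W" for n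
  proof -
    have "v n \<gamma> \<in> range ((*v) (W \<gamma>))" if "\<gamma> \<in> space M" for \<gamma>
      using L2_mp_range [OF L2_mp_scaleR [OF g_L2] that] by (simp add: v_def)
    moreover have "(\<integral>\<^sup>+\<gamma>. ennreal (mp_form (v n) \<gamma>) \<partial>M) = (\<integral>\<^sup>+\<gamma>. ennreal (mp_form (g n) \<gamma>) \<partial>M)"
      using AE_v by (intro nn_integral_cong_AE) (auto elim!: eventually_mono)
    ultimately show ?thesis
      using v_meas g_L2 [of n] by (simp add: L2_mp_def)
  qed
  have v_int: "(\<integral>\<gamma>. mp_form (v n) \<gamma> \<partial>M) = weight_form (f n)" for n
  proof -
    have "(\<integral>\<gamma>. mp_form (v n) \<gamma> \<partial>M) = (\<integral>\<gamma>. mp_form (g n) \<gamma> \<partial>M)"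
      using AE_v integrable_mp_form [OF g_L2] integrable_mp_form [OF v_L2]
      by (intro integral_cong_AE) (auto elim!: eventually_mono)
    also have "\<dots> = weight_form (f n)"
      unfolding weight_form_def g_def using weight_mult_L2_mp(2) [OF f]
      by (intro Bochner_Integration.integral_cong) auto
    finally show ?thesis .
  qed
  have lim: "(\<lambda>n. v n \<gamma>) \<longlonglongrightarrow> h \<gamma>" if "\<gamma> \<in> space M" for \<gamma>
  proof -
    have "convergent (\<lambda>n. v n \<gamma>)"
      using off_Z that by (cases "\<gamma> \<in> Z") (auto simp: v_def convergent_const)
    then show ?thesis
      by (simp add: h_def convergent_LIMSEQ_iff)
  qed
  have form_lim: "(\<lambda>n. \<integral>\<gamma>. mp_form (v n) \<gamma> \<partial>M) \<longlonglongrightarrow> D"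
    using D by (simp add: v_int)
  note h = L2_mp_Fatou [OF v_L2 lim form_lim]
  have "(\<lambda>n. weight_inner (f n) p) \<longlonglongrightarrow> (\<integral>\<gamma>. inner (h \<gamma>) (p \<gamma>) \<partial>M)"
    if p: "p \<in> bounded_measurable M" for p
  proof -
    obtain K where K: "0 \<le> K" "\<And>\<gamma>. \<gamma> \<in> space M \<Longrightarrow> norm (p \<gamma>) \<le> K"
      using bounded_measurable_bound [OF p] by blast
    have "(\<lambda>n. \<integral>\<gamma>. inner (v n \<gamma>) (p \<gamma>) \<partial>M) \<longlonglongrightarrow> (\<integral>\<gamma>. inner (h \<gamma>) (p \<gamma>) \<partial>M)"
    proof (rule integral_dominated_convergence)
      show "integrable M (\<lambda>\<gamma>. w \<gamma> * K)"
        using w by simp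
      show "(\<lambda>\<gamma>. inner (h \<gamma>) (p \<gamma>)) \<in> borel_measurable M"
        using L2_mp_measurable [OF h(1)] bounded_measurable_measurable [OF p] by simp
      show "(\<lambda>\<gamma>. inner (v n \<gamma>) (p \<gamma>)) \<in> borel_measurable M" for n
        using v_meas bounded_measurable_measurable [OF p] by simp
      show "AE \<gamma> in M. (\<lambda>n. inner (v n \<gamma>) (p \<gamma>)) \<longlonglongrightarrow> inner (h \<gamma>) (p \<gamma>)"
        by (intro AE_I2 tendsto_intros lim)
      show "AE \<gamma> in M. norm (inner (v n \<gamma>) (p \<gamma>)) \<le> w \<gamma> * K" for n
        using AE AE_v AE_space
      proof eventually_elim
        case (elim \<gamma>)
        have "norm (inner (v n \<gamma>) (p \<gamma>)) \<le> norm (g n \<gamma>) * norm (p \<gamma>)"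
          using elim by (simp add: Cauchy_Schwarz_ineq2)
        also have "\<dots> \<le> w \<gamma> * K"
          using elim K order_trans [OF norm_ge_zero] by (intro mult_mono) blast+
        finally show ?case .
      qed
    qed
    moreover have "(\<integral>\<gamma>. inner (v n \<gamma>) (p \<gamma>) \<partial>M) = weight_inner (f n) p" for n
      unfolding weight_inner_def
    proof (rule integral_cong_AE)
      show "AE \<gamma> in M. inner (v n \<gamma>) (p \<gamma>) = inner (W \<gamma> *v f n \<gamma>) (p \<gamma>)"
        using AE_v by (rule eventually_mono) (simp add: g_def)
    qed (use v_meas bounded_measurable_measurable [OF p] integrable_weight_inner [OF f p] in simp_all)
    ultimately show ?thesis
      by simp
  qed
  with h show thesis
    by (rule that)
qed

text \<open>With \<open>f\<^sub>n = g - t\<^sub>n\<close> a minimising sequence and \<open>h = lim W f\<^sub>n\<close>, near orthogonality of \<open>f\<^sub>n\<close> to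
  \<open>T\<close> becomes orthogonality of \<open>h\<close> to \<open>T\<close> in the limit. As \<open>g = f\<^sub>n + t\<^sub>n\<close> with the forms of the
  \<open>t\<^sub>n\<close> bounded, the pairing of \<open>h\<close> with \<open>g\<close> is \<open>lim weight_form f\<^sub>n = D\<close>. The last conclusion says that
  the complex number \<open>\<integral> h\<^sup>* g\<close>, whose real part is \<open>D\<close>, has no imaginary part.\<close>

lemma extremal_functional_exists:
  assumes T: "\<And>t. t \<in> T \<Longrightarrow> t \<in> bounded_measurable M"
    and T_diff: "\<And>t u c. t \<in> T \<Longrightarrow> u \<in> T \<Longrightarrow> (\<lambda>\<gamma>. t \<gamma> - c *\<^sub>R u \<gamma>) \<in> T"
    and T_imag: "\<And>t. t \<in> T \<Longrightarrow> (\<lambda>\<gamma>. \<i> *s t \<gamma>) \<in> T"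
    and g: "g \<in> bounded_measurable M"
    and lower: "\<And>t. t \<in> T \<Longrightarrow> D \<le> weight_form (\<lambda>\<gamma>. g \<gamma> - t \<gamma>)"
    and approx: "\<And>e. 0 < e \<Longrightarrow> \<exists>t\<in>T. weight_form (\<lambda>\<gamma>. g \<gamma> - t \<gamma>) \<le> D + e"
  obtains h where "h \<in> L2_mp M W" and "(\<integral>\<gamma>. mp_form h \<gamma> \<partial>M) \<le> D"
    and "\<And>t. t \<in> T \<Longrightarrow> (\<integral>\<gamma>. inner (h \<gamma>) (t \<gamma>) \<partial>M) = 0"
    and "(\<integral>\<gamma>. inner (h \<gamma>) (g \<gamma>) \<partial>M) = D"
    and "(\<integral>\<gamma>. inner (h \<gamma>) (\<i> *s g \<gamma>) \<partial>M) = 0"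
proof -
  have "\<exists>t. \<forall>n. t n \<in> T \<and> weight_form (\<lambda>\<gamma>. g \<gamma> - t n \<gamma>) \<le> D + (1 / 4) ^ n"
    using approx by (intro choice) (simp add: Bex_def)
  then obtain t where t: "\<And>n. t n \<in> T" and near: "\<And>n. weight_form (\<lambda>\<gamma>. g \<gamma> - t n \<gamma>) \<le> D + (1 / 4) ^ n"
    by blast
  define f where "f n \<gamma> = g \<gamma> - t n \<gamma>" for n \<gamma>
  have f: "f n \<in> bounded_measurable M" for n
    unfolding f_def using g T [OF t] by (rule bounded_measurable_diff)
  have near_f: "weight_form (f n) \<le> D + (1 / 4) ^ n" for n
    using near by (simp add: f_def [abs_def])
  have imag: "(\<lambda>\<gamma>. \<i> *s p \<gamma>) \<in> bounded_measurable M" if "p \<in> bounded_measurable M" for p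
    using that by (intro vector_scalar_mult_bounded_measurable [where C = 1]) simp_all
  have D_le: "D \<le> weight_form (\<lambda>\<gamma>. f n \<gamma> - c *\<^sub>R u \<gamma>)" if "u \<in> T" for n c u
  proof -
    have "(\<lambda>\<gamma>. t n \<gamma> - (- c) *\<^sub>R u \<gamma>) \<in> T"
      using t that by (rule T_diff)
    from lower [OF this] show ?thesis
      by (simp add: f_def algebra_simps)
  qed
  have D_le_f: "D \<le> weight_form (f n)" for n
    using lower [OF t] by (simp add: f_def [abs_def])
  have powers: "(\<lambda>n. (1 / 4 :: real) ^ n) \<longlonglongrightarrow> 0"
    by (intro LIMSEQ_realpow_zero) auto
  have values_lim: "(\<lambda>n. weight_form (f n)) \<longlonglongrightarrow> D"
  proof (rule tendsto_sandwich [of "\<lambda>_. D" _ _ "\<lambda>n. D + (1 / 4) ^ n"])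
    show "(\<lambda>n. D + (1 / 4) ^ n) \<longlonglongrightarrow> D"
      using tendsto_add [OF tendsto_const powers, of D] by simp
  qed (use D_le_f near_f in simp_all)
  have steps: "weight_form (\<lambda>\<gamma>. f n \<gamma> - f (Suc n) \<gamma>) \<le> 4 * (1 / 4) ^ n" for n
  proof -
    have u: "(\<lambda>\<gamma>. f n \<gamma> - f (Suc n) \<gamma>) \<in> T"
      using T_diff [OF t t, of "Suc n" 1 n] by (simp add: f_def)
    have "weight_form (\<lambda>\<gamma>. f n \<gamma> - f (Suc n) \<gamma>) \<le> 2 * ((1 / 4) ^ n + (1 / 4) ^ Suc n)"
      by (rule almost_minimal_difference(2) [OF f T [OF u] D_le [OF u] near_f])
         (use near_f [of "Suc n"] in simp)
    also have "\<dots> \<le> 4 * (1 / 4) ^ n"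
      by simp
    finally show ?thesis .
  qed
  obtain h where h: "h \<in> L2_mp M W" "(\<integral>\<gamma>. mp_form h \<gamma> \<partial>M) \<le> D"
    and h_lim: "\<And>p. p \<in> bounded_measurable M \<Longrightarrow>
           (\<lambda>n. weight_inner (f n) p) \<longlonglongrightarrow> (\<integral>\<gamma>. inner (h \<gamma>) (p \<gamma>) \<partial>M)"
    using weight_image_limit [OF f steps values_lim] by blast
  have to_zero: "(\<lambda>n. weight_inner (f n) (u n)) \<longlonglongrightarrow> 0"
    if u: "\<And>n. u n \<in> T" and C: "\<And>n. weight_form (u n) \<le> C" for u C
  proof -
    have bound: "(weight_inner (f n) (u n))\<^sup>2 \<le> (1 / 4) ^ n * C" for n
    proof -
      have "(weight_inner (f n) (u n))\<^sup>2 \<le> (1 / 4) ^ n * weight_form (u n)"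
        using f T [OF u] D_le [OF u] near_f by (rule almost_minimal_difference)
      also have "\<dots> \<le> (1 / 4) ^ n * C"
        using C by (intro mult_left_mono) auto
      finally show ?thesis .
    qed
    have "(\<lambda>n. (weight_inner (f n) (u n))\<^sup>2) \<longlonglongrightarrow> 0"
    proof (rule tendsto_sandwich [OF _ _ tendsto_const tendsto_mult_left_zero [OF powers, of C]])
    qed (simp_all add: bound)
    from tendsto_real_sqrt [OF this] show ?thesis
      by (simp add: tendsto_rabs_zero_iff)
  qed
  define C where "C = 2 * weight_form g + 2 * (D + 1)"
  have t_bound: "weight_form (t n) \<le> C" for n
  proof -
    have "t n = (\<lambda>\<gamma>. g \<gamma> - 1 *\<^sub>R f n \<gamma>)"
      by (simp add: f_def)
    then have "weight_form (t n) = weight_form (\<lambda>\<gamma>. g \<gamma> - 1 *\<^sub>R f n \<gamma>)"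
      by (rule arg_cong)
    also have "\<dots> = weight_form g - 2 * 1 * weight_inner g (f n) + 1\<^sup>2 * weight_form (f n)"
      using g f by (rule weight_form_diff_scaleR)
    finally have "weight_form (t n) = weight_form g - 2 * weight_inner g (f n) + weight_form (f n)"
      by simp
    moreover have "0 \<le> weight_form g + 2 * weight_inner g (f n) + weight_form (f n)"
      using weight_form_nonneg [of "\<lambda>\<gamma>. g \<gamma> - (- 1) *\<^sub>R f n \<gamma>"]
      unfolding weight_form_diff_scaleR [OF g f] by simp
    moreover have "weight_form (f n) \<le> D + 1"
      using near_f [of n] power_le_one [of "1 / 4 :: real" n] by simp
    ultimately show ?thesis
      by (simp add: C_def)
  qed
  have imag_bound: "weight_form (\<lambda>\<gamma>. \<i> *s t n \<gamma>) \<le> C" for n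
    using t_bound [of n] by (simp add: weight_form_def qform_imaginary_scale)
  have zero: "(\<integral>\<gamma>. inner (h \<gamma>) (u \<gamma>) \<partial>M) = 0" if "u \<in> T" for u
    using h_lim [OF T [OF that]] to_zero [of "\<lambda>_. u", OF that order_refl] by (rule LIMSEQ_unique)
  have "weight_inner (f n) g = weight_form (f n) + weight_inner (f n) (t n)" for n
  proof -
    have "weight_form (f n) = weight_inner (f n) (f n)"
      by (rule weight_inner_self [symmetric])
    also have "\<dots> = weight_inner (f n) (\<lambda>\<gamma>. g \<gamma> - t n \<gamma>)"
      by (simp add: f_def [abs_def])
    also have "\<dots> = weight_inner (f n) g - weight_inner (f n) (t n)"
      using f g T [OF t] by (rule weight_inner_diff_right)
    finally show ?thesis
      by simp
  qed
  then have "(\<lambda>n. weight_inner (f n) g) \<longlonglongrightarrow> D"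
    using tendsto_add [OF values_lim to_zero [of t, OF t t_bound]] by simp
  with h_lim [OF g] have hg: "(\<integral>\<gamma>. inner (h \<gamma>) (g \<gamma>) \<partial>M) = D"
    by (rule LIMSEQ_unique)
  have "weight_inner (f n) (\<lambda>\<gamma>. \<i> *s g \<gamma>) = weight_inner (f n) (\<lambda>\<gamma>. \<i> *s t n \<gamma>)" for n
  proof -
    have "weight_inner (f n) (\<lambda>\<gamma>. \<i> *s g \<gamma>) - weight_inner (f n) (\<lambda>\<gamma>. \<i> *s t n \<gamma>) = weight_inner (f n) (\<lambda>\<gamma>. \<i> *s f n \<gamma>)"
      unfolding weight_inner_diff_right [OF f imag [OF g] imag [OF T [OF t]], symmetric]
      by (simp add: f_def vector_ssub_ldistrib)
    also have "\<dots> = (\<integral>\<gamma>. 0 \<partial>M)"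
      unfolding weight_inner_def using W_psd
      by (intro Bochner_Integration.integral_cong) (auto simp: hermitian_inner_imaginary pos_semidef_adj)
    finally show ?thesis
      by simp
  qed
  then have "(\<lambda>n. weight_inner (f n) (\<lambda>\<gamma>. \<i> *s g \<gamma>)) \<longlonglongrightarrow> 0"
    using to_zero [of "\<lambda>n \<gamma>. \<i> *s t n \<gamma>", OF T_imag [OF t] imag_bound] by simp
  with h_lim [OF imag [OF g]] have hig: "(\<integral>\<gamma>. inner (h \<gamma>) (\<i> *s g \<gamma>) \<partial>M) = 0"
    by (rule LIMSEQ_unique)
  show thesis
    using h zero hg hig by (rule that)
qed

end

section \<open>Characters and trigonometric polynomials\<close>

lemma sets_haar_measure:
  assumes "haar_measure T m M"
  shows "sets M = sigma_sets (topspace T) {U. openin T U}"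
  using assms unfolding haar_measure_def by (rule conjunct1)

lemma space_haar_dual:
  fixes M :: "('g::topological_ab_group_add \<Rightarrow> complex) measure"
  assumes "haar_measure dual_topology dual_mult M"
  shows "space M = dual_group"
proof -
  have sets: "sets M = sigma_sets dual_group {U. openin dual_topology U}"
    using sets_haar_measure [OF assms] unfolding topspace_dual_topology .
  have "{U. openin dual_topology U} \<subseteq> Pow (dual_group :: ('g \<Rightarrow> complex) set)"
    using openin_subset [of dual_topology] by auto
  moreover have "space M \<in> sigma_sets dual_group {U. openin dual_topology U}"
    using sets.top [of M] unfolding sets .
  ultimately have "space M \<subseteq> dual_group"
    by (rule sigma_sets_into_sp)
  moreover have "dual_group \<in> sets M"
    unfolding sets by (rule sigma_sets_top)
  ultimately show ?thesis
    using sets.sets_into_space by blast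
qed

text \<open>Evaluation at \<open>x\<close> is continuous in the compact-open topology, because \<open>{x}\<close> is compact.\<close>

lemma evaluation_measurable:
  assumes haar: "haar_measure (dual_topology :: ('g::topological_ab_group_add \<Rightarrow> complex) topology) dual_mult M"
  shows "(\<lambda>\<gamma>. \<gamma> x) \<in> borel_measurable M"
proof (rule borel_measurableI)
  fix U :: "complex set"
  assume "open U"
  then have "openin dual_topology {\<gamma> \<in> dual_group :: ('g \<Rightarrow> complex) set. \<gamma> ` {x} \<subseteq> U}"
    unfolding dual_topology_def using \<open>open U\<close>
    by (intro topology_generated_by_Basis CollectI exI [of _ "{x}"] exI [of _ U]) simp
  then have "{\<gamma> \<in> dual_group. \<gamma> ` {x} \<subseteq> U} \<in> sets M"
    unfolding sets_haar_measure [OF haar] by (simp add: sigma_sets.Basic)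
  moreover have "(\<lambda>\<gamma>. \<gamma> x) -` U \<inter> space M = {\<gamma> \<in> dual_group. \<gamma> ` {x} \<subseteq> U}"
    using space_haar_dual [OF haar] by auto
  ultimately show "(\<lambda>\<gamma>. \<gamma> x) -` U \<inter> space M \<in> sets M"
    by simp
qed

lemma character_norm: "\<gamma> \<in> dual_group \<Longrightarrow> norm (\<gamma> x) = 1"
  by (simp add: dual_group_def)

lemma character_vector_bounded_measurable:
  assumes haar: "haar_measure dual_topology dual_mult M"
  shows "(\<lambda>\<gamma>. \<gamma> x *s u) \<in> bounded_measurable M"
proof (rule vector_scalar_mult_bounded_measurable [where C = 1])
  show "(\<lambda>\<gamma>. u) \<in> bounded_measurable M"
    unfolding bounded_measurable_def
    by (intro CollectI conjI borel_measurable_const exI [of _ "norm u"]) simp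
  show "norm (\<gamma> x) \<le> 1" if "\<gamma> \<in> space M" for \<gamma>
    using that space_haar_dual [OF haar] by (simp add: character_norm)
qed (rule evaluation_measurable [OF haar])

lemma zero_in_trig_polys: "(\<lambda>\<gamma>. 0) \<in> trig_polys X"
  unfolding trig_polys_def by (rule CollectI, rule exI [of _ 0]) simp

lemma trig_polys_add_term:
  assumes "t \<in> trig_polys X" and "y \<in> X"
  shows "(\<lambda>\<gamma>. t \<gamma> + \<gamma> y *s v) \<in> trig_polys X"
proof -
  obtain n :: nat and x u where t: "t = (\<lambda>\<gamma>. \<Sum>j<n. \<gamma> (x j) *s u j)" and x: "\<forall>j<n. x j \<in> X"
    using assms(1) by (auto simp: trig_polys_def)
  have "(\<lambda>\<gamma>. t \<gamma> + \<gamma> y *s v) = (\<lambda>\<gamma>. \<Sum>j<Suc n. \<gamma> ((x(n := y)) j) *s (u(n := v)) j)"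
    by (simp add: t)
  moreover have "\<forall>j<Suc n. (x(n := y)) j \<in> X"
    using x assms(2) by (simp add: less_Suc_eq)
  ultimately show ?thesis
    unfolding trig_polys_def
    by (intro CollectI exI [of _ "Suc n"] exI [of _ "x(n := y)"] exI [of _ "u(n := v)"] conjI)
qed

lemma trig_polys_add_sum:
  assumes "t \<in> trig_polys X" and "\<forall>j<(n::nat). x j \<in> X"
  shows "(\<lambda>\<gamma>. t \<gamma> + (\<Sum>j<n. \<gamma> (x j) *s u j)) \<in> trig_polys X"
  using assms(2)
proof (induction n)
  case 0
  then show ?case
    using assms(1) by simp
next
  case (Suc n)
  then show ?case
    using trig_polys_add_term [of "\<lambda>\<gamma>. t \<gamma> + (\<Sum>j<n. \<gamma> (x j) *s u j)" X "x n" "u n"]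
    by (simp add: add.assoc)
qed

lemma trig_polys_add_scale:
  assumes "t \<in> trig_polys X" and "p \<in> trig_polys X"
  shows "(\<lambda>\<gamma>. t \<gamma> + c *s p \<gamma>) \<in> trig_polys X"
proof -
  obtain n :: nat and x u where p: "p = (\<lambda>\<gamma>. \<Sum>j<n. \<gamma> (x j) *s u j)" and x: "\<forall>j<n. x j \<in> X"
    using assms(2) by (auto simp: trig_polys_def)
  have "(\<lambda>\<gamma>. t \<gamma> + c *s p \<gamma>) = (\<lambda>\<gamma>. t \<gamma> + (\<Sum>j<n. \<gamma> (x j) *s (c *s u j)))"
    by (simp only: p vec.scale_sum_right vector_smult_assoc mult.commute [of c])
  then show ?thesis
    using trig_polys_add_sum [OF assms(1) x, of "\<lambda>j. c *s u j"] by simp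
qed

lemma character_vector_in_trig_polys: "x \<in> X \<Longrightarrow> (\<lambda>\<gamma>. \<gamma> x *s u) \<in> trig_polys X"
  using trig_polys_add_term [OF zero_in_trig_polys] by simp

lemma trig_polys_bounded_measurable:
  assumes haar: "haar_measure dual_topology dual_mult M" and "t \<in> trig_polys X"
  shows "t \<in> bounded_measurable M"
proof -
  obtain n :: nat and x u where t: "t = (\<lambda>\<gamma>. \<Sum>j<n. \<gamma> (x j) *s u j)"
    using assms(2) by (auto simp: trig_polys_def)
  have "(\<lambda>\<gamma>. \<Sum>j<n. \<gamma> (x j) *s u j) \<in> bounded_measurable M"
  proof (induction n)
    case 0
    then show ?case
      unfolding bounded_measurable_def
      by (intro CollectI conjI exI [of _ 0]) simp_all
  next
    case (Suc n)
    then show ?case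
      using bounded_measurable_diff_scaleR
        [OF Suc character_vector_bounded_measurable [OF haar], of "-1" "x n" "u n"] by simp
  qed
  then show ?thesis
    by (simp add: t)
qed

section \<open>Fourier conditions as orthogonality\<close>

lemma row_col_add: "row_col (r + r') v = row_col r v + row_col r' v"
  by (simp add: row_col_def distrib_right sum.distrib)

lemma row_col_scaleR: "row_col (c *\<^sub>R r) v = c *\<^sub>R row_col r v"
  by (simp add: row_col_def scaleR_sum_right)

lemma row_col_scale: "row_col (c *s r) v = row_col r (c *s v)"
  by (simp add: row_col_def mult.assoc mult.left_commute)

text \<open>This converts the Fourier conditions in the dual problem into real pairings with the functions
  \<open>\<chi>\<^sub>x u\<close>; letting \<open>u\<close> range over complex vectors recovers the imaginary parts.\<close>

lemma Re_row_col_inv_fourier_adj: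
  assumes haar: "haar_measure dual_topology dual_mult M" and h: "integrable M h"
  shows "Re (row_col (inv_fourier_adj M h x) u) = (\<integral>\<gamma>. inner (h \<gamma>) (\<gamma> x *s u) \<partial>M)"
proof -
  have adj: "bounded_linear (vec_adj :: complex ^ 'n \<Rightarrow> complex ^ 'n)"
    unfolding linear_conv_bounded_linear [symmetric]
    by (rule linearI) (simp_all add: vec_adj_def vec_eq_iff)
  have lin: "bounded_linear (\<lambda>r. Re (row_col r u))"
    unfolding linear_conv_bounded_linear [symmetric]
    by (rule linearI) (simp_all add: row_col_add row_col_scaleR)
  have adj_int: "integrable M (\<lambda>\<gamma>. vec_adj (h \<gamma>))"
    using h by (rule integrable_bounded_linear [OF adj])
  have "integrable M (\<lambda>\<gamma>. \<gamma> x *s vec_adj (h \<gamma>))"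
  proof (rule Bochner_Integration.integrable_bound [OF adj_int])
    show "(\<lambda>\<gamma>. \<gamma> x *s vec_adj (h \<gamma>)) \<in> borel_measurable M"
      using adj_int by (intro vector_scalar_mult_measurable evaluation_measurable [OF haar]) auto
    show "AE \<gamma> in M. norm (\<gamma> x *s vec_adj (h \<gamma>)) \<le> norm (vec_adj (h \<gamma>))"
      using space_haar_dual [OF haar] by (intro AE_I2) (simp add: norm_vector_scalar_mult character_norm)
  qed
  then have "Re (row_col (inv_fourier_adj M h x) u) =
      (\<integral>\<gamma>. Re (row_col (\<gamma> x *s vec_adj (h \<gamma>)) u) \<partial>M)"
    unfolding inv_fourier_adj_def by (rule integral_bounded_linear [OF lin, symmetric])
  also have "\<dots> = (\<integral>\<gamma>. inner (h \<gamma>) (\<gamma> x *s u) \<partial>M)"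
    by (simp only: row_col_scale Re_row_col_vec_adj)
  finally show ?thesis .
qed

lemma row_vector_eq_zero:
  assumes "\<And>u. Re (row_col r u) = 0"
  shows "r = 0"
proof -
  have "vec_adj (vec_adj r) = r"
    by (simp add: vec_adj_def vec_eq_iff)
  then have "inner (vec_adj r) (vec_adj r) = 0"
    using assms [of "vec_adj r"] Re_row_col_vec_adj [of "vec_adj r" "vec_adj r"] by simp
  then show ?thesis
    by (simp add: vec_adj_def vec_eq_iff)
qed

lemma Re_row_col_imaginary: "Re (row_col r (\<i> *s u)) = - Im (row_col r u)"
proof -
  have "row_col r (\<i> *s u) = \<i> * row_col r u"
    by (simp add: row_col_def sum_distrib_left mult.left_commute)
  then show ?thesis
    by simp
qed

lemma integral_inner_trig_poly_zero:
  assumes haar: "haar_measure dual_topology dual_mult M" and h: "integrable M h"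
    and zero: "\<And>x. x \<in> X \<Longrightarrow> inv_fourier_adj M h x = 0" and t: "t \<in> trig_polys X"
  shows "(\<integral>\<gamma>. inner (h \<gamma>) (t \<gamma>) \<partial>M) = 0"
proof -
  obtain n :: nat and x u where t: "t = (\<lambda>\<gamma>. \<Sum>j<n. \<gamma> (x j) *s u j)" and x: "\<forall>j<n. x j \<in> X"
    using t by (auto simp: trig_polys_def)
  have "(\<integral>\<gamma>. inner (h \<gamma>) (t \<gamma>) \<partial>M) = (\<Sum>j<n. \<integral>\<gamma>. inner (h \<gamma>) (\<gamma> (x j) *s u j) \<partial>M)"
    unfolding t inner_sum_right
    by (intro Bochner_Integration.integral_sum integrable_inner_bounded h
        character_vector_bounded_measurable haar)
  also have "\<dots> = 0"
    using x by (simp add: zero row_col_def flip: Re_row_col_inv_fourier_adj [OF haar h])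
  finally show ?thesis .
qed

lemma D_tilde_atI:
  assumes haar: "haar_measure dual_topology dual_mult M" and h: "h \<in> L2_mp M W" "integrable M h"
    and zero: "\<And>t. t \<in> trig_polys (UNIV - S) \<Longrightarrow> (\<integral>\<gamma>. inner (h \<gamma>) (t \<gamma>) \<partial>M) = 0"
    and re: "(\<integral>\<gamma>. inner (h \<gamma>) (\<gamma> s *s axis k 1) \<partial>M) = 1"
    and im: "(\<integral>\<gamma>. inner (h \<gamma>) (\<i> *s (\<gamma> s *s axis k 1)) \<partial>M) = 0"
  shows "h \<in> D_tilde_at M W S s k"
proof -
  note fourier = Re_row_col_inv_fourier_adj [OF haar h(2)]
  have "inv_fourier_adj M h x = 0" if "x \<in> UNIV - S" for x
  proof (rule row_vector_eq_zero)
    show "Re (row_col (inv_fourier_adj M h x) u) = 0" for u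
      unfolding fourier by (rule zero [OF character_vector_in_trig_polys [OF that]])
  qed
  moreover have "row_col (inv_fourier_adj M h s) (axis k 1) = 1"
  proof (rule complex_eqI)
    show "Re (row_col (inv_fourier_adj M h s) (axis k 1)) = Re 1"
      by (simp add: fourier re)
    have "- Im (row_col (inv_fourier_adj M h s) (axis k 1)) =
        (\<integral>\<gamma>. inner (h \<gamma>) (\<gamma> s *s (\<i> *s axis k 1)) \<partial>M)"
      unfolding Re_row_col_imaginary [symmetric] by (rule fourier)
    also have "\<dots> = 0"
      using im by (simp add: mult.commute)
    finally have "- Im (row_col (inv_fourier_adj M h s) (axis k 1)) = 0" .
    then show "Im (row_col (inv_fourier_adj M h s) (axis k 1)) = Im 1"
      by simp
  qed
  ultimately show ?thesis
    using h(1) by (simp add: D_tilde_at_def D_tilde_def)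
qed

section \<open>The duality theorem\<close>

theorem theorem5p5:
  fixes M :: "('g::{topological_ab_group_add, t2_space} \<Rightarrow> complex) measure"
    and W :: "('g \<Rightarrow> complex) \<Rightarrow> complex ^ 'q ^ 'q"
    and S :: "'g set" and s :: 'g and k :: 'q
  assumes "locally_compact_space (euclidean :: 'g topology)"
    and "haar_measure dual_topology dual_mult M"
    and "S \<noteq> {}"
    and "W \<in> borel_measurable M"
    and "integrable M W"
    and "\<forall>\<gamma>\<in>dual_group. pos_semidef (W \<gamma>)"
    and "s \<in> S"
  shows "(INF t\<in>trig_polys (UNIV - S).
            ereal (sqrt (\<integral>\<gamma>. qform (W \<gamma>) (\<gamma> s *s axis k 1 - t \<gamma>) \<partial>M))) =
         (if D_tilde_at M W S s k = {} then 0
          else (SUP h\<in>D_tilde_at M W S s k.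
                  1 / ereal (sqrt (\<integral>\<gamma>. qform (mp_inverse (W \<gamma>)) (h \<gamma>) \<partial>M))))"
proof -
  note haar = assms(2)
  interpret matrix_weight M W
    using assms(5,6) space_haar_dual [OF haar] by unfold_locales auto
  define T where "T = (trig_polys (UNIV - S) :: (('g \<Rightarrow> complex) \<Rightarrow> complex ^ 'q) set)"
  define g where "g = (\<lambda>\<gamma>. \<gamma> s *s axis k 1 :: complex ^ 'q)"
  define P where "P h = (\<integral>\<gamma>. mp_form h \<gamma> \<partial>M)" for h
  define E where "E = D_tilde_at M W S s k"
  define d where "d = (INF t\<in>T. ereal (sqrt (weight_form (\<lambda>\<gamma>. g \<gamma> - t \<gamma>))))"
  have g: "g \<in> bounded_measurable M"
    unfolding g_def using haar by (rule character_vector_bounded_measurable)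
  have T: "t \<in> bounded_measurable M" if "t \<in> T" for t
    using trig_polys_bounded_measurable [OF haar] that by (simp add: T_def)
  have P_nonneg: "0 \<le> P h" if "h \<in> E" for h
    unfolding P_def using that L2_mp_form_nonneg [of h]
    by (intro integral_nonneg_AE AE_I2) (simp add: E_def D_tilde_at_def D_tilde_def)
  have weak: "1 \<le> P h * weight_form (\<lambda>\<gamma>. g \<gamma> - t \<gamma>)" if hE: "h \<in> E" and t: "t \<in> T" for h t
    unfolding P_def
  proof (rule L2_mp_pairing_bound)
    show h: "h \<in> L2_mp M W"
      using hE by (simp add: E_def D_tilde_at_def D_tilde_def)
    note h_int = integrable_L2_mp [OF h]
    show "(\<lambda>\<gamma>. g \<gamma> - t \<gamma>) \<in> bounded_measurable M"
      using g T [OF t] by (rule bounded_measurable_diff)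
    have "(\<integral>\<gamma>. inner (h \<gamma>) (g \<gamma>) \<partial>M) = 1"
      using hE by (simp add: g_def E_def D_tilde_at_def flip: Re_row_col_inv_fourier_adj [OF haar h_int])
    moreover have "(\<integral>\<gamma>. inner (h \<gamma>) (t \<gamma>) \<partial>M) = 0"
      using hE t by (intro integral_inner_trig_poly_zero [OF haar h_int, of "UNIV - S"])
        (auto simp: T_def E_def D_tilde_at_def D_tilde_def)
    ultimately show "(\<integral>\<gamma>. inner (h \<gamma>) (g \<gamma> - t \<gamma>) \<partial>M) = 1"
      using integrable_inner_bounded [OF h_int g] integrable_inner_bounded [OF h_int T [OF t]]
      by (simp add: inner_diff_right)
  qed
  have P_pos: "0 < P h" if "h \<in> E" for h
    using weak [OF that, of "\<lambda>_. 0"] P_nonneg [OF that] zero_in_trig_polys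
    by (cases "P h = 0") (auto simp: T_def)
  have recip: "1 / ereal (sqrt (P h)) = ereal (1 / sqrt (P h))" if "h \<in> E" for h
    using P_pos [OF that] by (simp add: one_ereal_def)
  have upper: "1 / ereal (sqrt (P h)) \<le> d" if h: "h \<in> E" for h
    unfolding d_def recip [OF h]
  proof (rule INF_greatest)
    fix t
    assume "t \<in> T"
    from weak [OF h this] have "1 \<le> sqrt (P h) * sqrt (weight_form (\<lambda>\<gamma>. g \<gamma> - t \<gamma>))"
      by (simp flip: real_sqrt_mult)
    then show "ereal (1 / sqrt (P h)) \<le> ereal (sqrt (weight_form (\<lambda>\<gamma>. g \<gamma> - t \<gamma>)))"
      using P_pos [OF h] by (simp add: field_simps)
  qed
  have d_nonneg: "0 \<le> d"
    unfolding d_def by (intro INF_greatest) (simp add: weight_form_nonneg)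
  have attained: "\<exists>h\<in>E. d \<le> 1 / ereal (sqrt (P h))" if "d \<noteq> 0"
  proof -
    have "d \<le> ereal (sqrt (weight_form (\<lambda>\<gamma>. g \<gamma> - 0)))"
      unfolding d_def T_def by (rule INF_lower [OF zero_in_trig_polys])
    then obtain r where r: "d = ereal r"
      using d_nonneg by (cases d) auto
    have r_pos: "0 < r"
      using d_nonneg that by (simp add: r)
    have lower: "r\<^sup>2 \<le> weight_form (\<lambda>\<gamma>. g \<gamma> - t \<gamma>)" if "t \<in> T" for t
    proof -
      have "d \<le> ereal (sqrt (weight_form (\<lambda>\<gamma>. g \<gamma> - t \<gamma>)))"
        unfolding d_def by (rule INF_lower [OF that])
      then show ?thesis
        using r_pos by (simp add: r real_le_rsqrt sqrt_ge_absD)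
    qed
    have approx: "\<exists>t\<in>T. weight_form (\<lambda>\<gamma>. g \<gamma> - t \<gamma>) \<le> r\<^sup>2 + e" if "0 < e" for e
    proof -
      have "r < sqrt (r\<^sup>2 + e)"
        using r_pos that by (intro real_less_rsqrt) simp
      then have "d < ereal (sqrt (r\<^sup>2 + e))"
        by (simp add: r)
      then obtain t where "t \<in> T" "sqrt (weight_form (\<lambda>\<gamma>. g \<gamma> - t \<gamma>)) < sqrt (r\<^sup>2 + e)"
        unfolding d_def INF_less_iff by auto
      then show ?thesis
        by (auto intro: less_imp_le)
    qed
    have T_diff: "(\<lambda>\<gamma>. t \<gamma> - c *\<^sub>R u \<gamma>) \<in> T" if "t \<in> T" "u \<in> T" for t u c
    proof -
      have "(\<lambda>\<gamma>. t \<gamma> - c *\<^sub>R u \<gamma>) = (\<lambda>\<gamma>. t \<gamma> + complex_of_real (- c) *s u \<gamma>)"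
        by (simp add: fun_eq_iff vec_eq_iff) (simp add: scaleR_conv_of_real)
      also have "\<dots> \<in> T"
        using that unfolding T_def by (rule trig_polys_add_scale)
      finally show ?thesis .
    qed
    have T_imag: "(\<lambda>\<gamma>. \<i> *s t \<gamma>) \<in> T" if "t \<in> T" for t
      using trig_polys_add_scale [OF zero_in_trig_polys, of t _ "\<i>"] that by (simp add: T_def)
    obtain h where h: "h \<in> L2_mp M W" and h_form: "(\<integral>\<gamma>. mp_form h \<gamma> \<partial>M) \<le> r\<^sup>2"
      and h_zero: "\<And>t. t \<in> T \<Longrightarrow> (\<integral>\<gamma>. inner (h \<gamma>) (t \<gamma>) \<partial>M) = 0"
      and h_re: "(\<integral>\<gamma>. inner (h \<gamma>) (g \<gamma>) \<partial>M) = r\<^sup>2"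
      and h_im: "(\<integral>\<gamma>. inner (h \<gamma>) (\<i> *s g \<gamma>) \<partial>M) = 0"
      using extremal_functional_exists [OF T T_diff T_imag g lower approx] by blast
    \<comment> \<open>The pairing of \<open>h\<close> with \<open>g\<close> is \<open>r\<^sup>2\<close>, so this is the normalisation to pairing \<open>1\<close>.\<close>
    define h' where "h' = (\<lambda>\<gamma>. (1 / r\<^sup>2) *\<^sub>R h \<gamma>)"
    have h': "h' \<in> L2_mp M W"
      unfolding h'_def using h by (rule L2_mp_scaleR)
    have "h' \<in> E"
      unfolding E_def
    proof (rule D_tilde_atI [OF haar h' integrable_L2_mp [OF h']])
      show "(\<integral>\<gamma>. inner (h' \<gamma>) (t \<gamma>) \<partial>M) = 0" if "t \<in> trig_polys (UNIV - S)" for t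
        using h_zero that by (simp add: h'_def T_def)
      show "(\<integral>\<gamma>. inner (h' \<gamma>) (\<gamma> s *s axis k 1) \<partial>M) = 1"
        using h_re r_pos by (simp add: h'_def g_def)
      show "(\<integral>\<gamma>. inner (h' \<gamma>) (\<i> *s (\<gamma> s *s axis k 1)) \<partial>M) = 0"
        using h_im by (simp add: h'_def g_def)
    qed
    moreover have "d \<le> 1 / ereal (sqrt (P h'))"
    proof -
      have "P h' = (1 / r\<^sup>2)\<^sup>2 * (\<integral>\<gamma>. mp_form h \<gamma> \<partial>M)"
        unfolding P_def h'_def mp_form_scaleR by simp
      also have "\<dots> \<le> (1 / r\<^sup>2)\<^sup>2 * r\<^sup>2"
        using h_form by (rule mult_left_mono) simp
      also have "\<dots> = (1 / r)\<^sup>2"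
        using r_pos by (simp add: field_simps power2_eq_square)
      finally have "sqrt (P h') \<le> 1 / r"
        using r_pos by (intro real_le_lsqrt) simp_all
      then show ?thesis
        using P_pos [OF \<open>h' \<in> E\<close>] r_pos unfolding recip [OF \<open>h' \<in> E\<close>] r
        by (simp add: field_simps)
    qed
    ultimately show ?thesis
      by blast
  qed
  have "d = (if E = {} then 0 else (SUP h\<in>E. 1 / ereal (sqrt (P h))))"
  proof (cases "E = {}")
    case True
    then show ?thesis
      using attained by auto
  next
    case False
    have "d \<le> (SUP h\<in>E. 1 / ereal (sqrt (P h)))"
    proof (cases "d = 0")
      case True
      obtain h where h: "h \<in> E"
        using False by blast
      have "0 \<le> 1 / ereal (sqrt (P h))"
        using P_pos [OF h] by (simp add: recip [OF h])
      then show ?thesis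
        unfolding True using h by (rule SUP_upper2 [rotated])
    next
      case False
      then show ?thesis
        using attained by (blast intro: SUP_upper2)
    qed
    moreover have "(SUP h\<in>E. 1 / ereal (sqrt (P h))) \<le> d"
      using upper by (rule SUP_least)
    ultimately show ?thesis
      using False by simp
  qed
  then show ?thesis
    by (simp add: d_def E_def P_def T_def g_def weight_form_def)
qed

end
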